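(* For all positive integers $d$, $k<d$ and $p\ge k+2$ there exists a constant $C$ such that the following holds. If $\mathcal{F}_1,\ldots,\mathcal{F}_p$ are families of closed balls in $\mathbb{R}^d$ such that for every choice $B_1\in\mathcal{F}_1,\ldots,B_p\in\mathcal{F}_p$ there are $k+2$ among $B_1,\ldots,B_p$ that can be hit by a single $k$-flat, then there exist an index $i\in\{1,\ldots,p\}$ and at most $C$ $k$-flats such that every ball of $\mathcal{F}_i$ is intersected by one of them.
   Context: A $k$-flat is a $k$-dimensional affine subspace of $\mathbb{R}^d$; a flat hits a set if they intersect. *)

theory Defs imports "HOL-Analysis.Analysis" begin

definition flat :: "nat \<Rightarrow> 'a::euclidean_space set \<Rightarrow> bool" where
  "flat k L \<longleftrightarrow> affine L \<and> aff_dim L = int k"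

definition hits :: "'a set \<Rightarrow> 'a set \<Rightarrow> bool" where
  "hits L S \<longleftrightarrow> L \<inter> S \<noteq> {}"

text \<open>Radius 0 is allowed, so a single point counts as a closed ball;
  a negative radius is excluded because then cball is empty.\<close>

definition closed_ball :: "'a::metric_space set \<Rightarrow> bool" where
  "closed_ball B \<longleftrightarrow> (\<exists>x r. 0 \<le> r \<and> B = cball x r)"

end

theory Submission imports Defs "HOL-Real_Asymp.Real_Asymp" begin

text \<open>If \<open>k + 2\<close> balls are hit by a \<open>k\<close>-flat, one of them is hit by the flat through suitable points
  of finite nets of the other \<open>k + 1\<close> balls, where the net of a ball depends on that ball only: lift
  points \<open>x\<close> to \<open>(x, 1)\<close>, take a linear dependency between the lifted points, and replace one ball
  after the other by a point of its net. So \<open>k + 1\<close> balls determine boundedly many flats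
  that matter for a further ball.

  Suppose that each family carries a probability weight for which every \<open>k\<close>-flat hits little weight.
  Then, by the union bound, a random rainbow choice has no \<open>k + 2\<close> balls on a common \<open>k\<close>-flat. If a
  finite family has no such weight, multiplicative weight updates give a list of flats of which every
  ball is hit by a fixed fraction. Since hitting a given ball is a half-space condition after linearising
  the squared distance, an \<open>\<epsilon>\<close>-net consisting of boundedly many of these flats hits all balls.
  Compactness of the set of frames passes from finite to infinite families.\<close>

section \<open>Shattering and separated set families\<close>

text \<open>The flats hitting \<open>k + 1\<close> given balls form a continuum, so no union bound
  applies to them directly. Finite nets cure this, provided the net of a ball ignores the ball still
  to be hit: once the other \<open>k + 1\<close> balls are fixed, the dangerous flats for the
  remaining family are fixed too, and its weight bound applies to each of them. Which ball ends up
  being hit cannot be prescribed, because the order of replacement follows the products of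
  coefficient and radius. Hence the union runs over pairs of an index set and a distinguished index.

  The list of flats from the weight updates has a length that grows with the logarithm of the family
  size; only the fraction is uniform. A bound independent of the family comes from the fixed
  dimension of the linearised space, in which flats are points and balls are half-spaces.
  Half-spaces enter only as convex sets with convex complement, so the theorems of Helly,
  Caratheodory and Radon suffice for the net.\<close>

definition shatters :: "'a set set \<Rightarrow> 'a set \<Rightarrow> bool" where
  "shatters \<A> S \<longleftrightarrow> (\<forall>T\<subseteq>S. \<exists>A\<in>\<A>. A \<inter> S = T)"

text \<open>Pajor's form of the Sauer-Shelah lemma. Deleting \<open>x\<close> merges two members
  exactly when the result lies in both \<open>P\<close> and \<open>R\<close>, so
  \<open>P \<union> R\<close> and \<open>P \<inter> R\<close> together have as many members as
  \<open>\<A>\<close>. Sets shattered by \<open>P \<union> R\<close> avoid \<open>x\<close>, those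
  shattered by \<open>P \<inter> R\<close> can be enlarged by \<open>x\<close>, and so nothing is
  counted twice.\<close>

lemma card_le_card_shattered:
  assumes "finite X" "\<A> \<subseteq> Pow X"
  shows "card \<A> \<le> card {S\<in>Pow X. shatters \<A> S}"
  using assms
proof (induction X arbitrary: \<A> rule: finite_induct)
  case empty
  then consider "\<A> = {}" | "\<A> = {{}}" by (metis Pow_empty subset_singletonD)
  then show ?case
  proof cases
    case 2
    have "{S \<in> Pow {}. shatters \<A> S} = {{}}" using 2 by (auto simp: shatters_def)
    then show ?thesis using 2 by simp
  qed simp
next
  case (insert x X)
  define P where "P = {A\<in>\<A>. x \<notin> A}"
  define R where "R = (\<lambda>A. A - {x}) ` {A\<in>\<A>. x \<in> A}"
  have fA: "finite \<A>" using insert by (meson finite.insertI finite_Pow_iff finite_subset)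
  have PX: "P \<subseteq> Pow X" using insert.prems by (auto simp: P_def)
  have RX: "R \<subseteq> Pow X" using insert.prems by (auto simp: R_def)
  have inj: "inj_on (\<lambda>A. A - {x}) {A\<in>\<A>. x \<in> A}" by (auto simp: inj_on_def)
  have "\<A> = P \<union> {A\<in>\<A>. x \<in> A}" by (auto simp: P_def)
  moreover have "P \<inter> {A\<in>\<A>. x \<in> A} = {}" by (auto simp: P_def)
  ultimately have "card \<A> = card P + card {A\<in>\<A>. x \<in> A}"
    using fA by (metis (no_types, lifting) card_Un_disjoint finite_Un)
  also have "card {A\<in>\<A>. x \<in> A} = card R" unfolding R_def by (simp add: card_image inj)
  also have "card P + card R = card (P \<union> R) + card (P \<inter> R)"
    using fA by (intro card_Un_Int) (auto simp: P_def R_def)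
  finally have eq: "card \<A> = card (P \<union> R) + card (P \<inter> R)" .
  have 1: "card (P \<union> R) \<le> card {S\<in>Pow X. shatters (P \<union> R) S}"
    using insert.IH[of "P \<union> R"] PX RX by blast
  have 2: "card (P \<inter> R) \<le> card {S\<in>Pow X. shatters (P \<inter> R) S}"
    using insert.IH[of "P \<inter> R"] PX by blast
  let ?S1 = "{S\<in>Pow X. shatters (P \<union> R) S}"
  let ?S2 = "insert x ` {S\<in>Pow X. shatters (P \<inter> R) S}"
  have f: "finite ?S1" "finite ?S2" using insert.hyps by auto
  have inj2: "inj_on (insert x) {S\<in>Pow X. shatters (P \<inter> R) S}"
    using insert.hyps by (auto simp: inj_on_def)
  have disj: "?S1 \<inter> ?S2 = {}" using insert.hyps by auto
  have s1: "shatters \<A> S" if asm: "S \<subseteq> X" "shatters (P \<union> R) S" for S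
    unfolding shatters_def
  proof (intro allI impI)
    fix T assume "T \<subseteq> S"
    then obtain A where A: "A \<in> P \<union> R" "A \<inter> S = T" using asm unfolding shatters_def by blast
    show "\<exists>A\<in>\<A>. A \<inter> S = T"
    proof (cases "A \<in> P")
      case True then show ?thesis using A by (auto simp: P_def)
    next
      case False
      then obtain B where "B \<in> \<A>" "A = B - {x}" using A by (auto simp: R_def)
      moreover have "x \<notin> S" using asm insert.hyps by auto
      ultimately show ?thesis using A by blast
    qed
  qed
  have s2: "shatters \<A> (insert x S)" if asm: "S \<subseteq> X" "shatters (P \<inter> R) S" for S
    unfolding shatters_def
  proof (intro allI impI)
    fix T assume T: "T \<subseteq> insert x S"
    have xS: "x \<notin> S" using asm insert.hyps by auto
    have "T - {x} \<subseteq> S" using T by auto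
    then obtain A where A: "A \<in> P" "A \<in> R" "A \<inter> S = T - {x}"
      using asm unfolding shatters_def by blast
    then have "A \<in> \<A>" "x \<notin> A" by (auto simp: P_def)
    moreover obtain B where B: "B \<in> \<A>" "x \<in> B" "A = B - {x}" using A by (auto simp: R_def)
    ultimately show "\<exists>A\<in>\<A>. A \<inter> insert x S = T"
    proof (cases "x \<in> T")
      case True
      then have "B \<inter> insert x S = T" using A B xS T by auto
      then show ?thesis using B by blast
    next
      case False
      then have "A \<inter> insert x S = T" using A xS T \<open>x \<notin> A\<close> by auto
      then show ?thesis using \<open>A \<in> \<A>\<close> by blast
    qed
  qed
  have "card \<A> \<le> card ?S1 + card ?S2"
    using eq 1 2 unfolding card_image[OF inj2] by linarith
  also have "\<dots> = card (?S1 \<union> ?S2)" using f disj by (simp add: card_Un_disjoint)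
  also have "\<dots> \<le> card {S\<in>Pow (insert x X). shatters \<A> S}"
    by (intro card_mono) (use insert.hyps s1 s2 in auto)
  finally show ?case .
qed

lemma card_subsets_card_le:
  assumes "finite X"
  shows "card {S. S \<subseteq> X \<and> card S \<le> D} \<le> (card X + 1) ^ D"
proof (induction D)
  case 0
  have "{S. S \<subseteq> X \<and> card S \<le> 0} = {{}}" using assms finite_subset by fastforce
  then show ?case by simp
next
  case (Suc D)
  \<comment> \<open>\<open>None\<close> adds nothing, which is how the empty set is reached.\<close>
  let ?A = "{S. S \<subseteq> X \<and> card S \<le> D}" and ?X = "insert None (Some ` X)"
  let ?f = "\<lambda>(S, y). case y of None \<Rightarrow> S | Some x \<Rightarrow> insert x S"
  have fin: "finite (?A \<times> ?X)" using assms by auto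
  have "S \<in> ?f ` (?A \<times> ?X)" if S: "S \<subseteq> X" "card S \<le> Suc D" for S
  proof (cases "S = {}")
    case True
    then show ?thesis by (intro image_eqI[of _ _ "({}, None)"]) auto
  next
    case False
    then obtain x where x: "x \<in> S" by blast
    have "card (S - {x}) \<le> D" using S x assms finite_subset by (simp add: card_Diff_singleton)
    then show ?thesis using S x by (intro image_eqI[of _ _ "(S - {x}, Some x)"]) auto
  qed
  then have "{S. S \<subseteq> X \<and> card S \<le> Suc D} \<subseteq> ?f ` (?A \<times> ?X)" by blast
  then have "card {S. S \<subseteq> X \<and> card S \<le> Suc D} \<le> card (?A \<times> ?X)"
    using fin by (meson card_image_le card_mono finite_imageI le_trans)
  also have "\<dots> = card ?A * (card X + 1)"
    using assms by (simp add: card_cartesian_product card_image)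
  also have "\<dots> \<le> (card X + 1) ^ D * (card X + 1)" using Suc by (intro mult_right_mono) auto
  finally show ?case by (simp add: algebra_simps)
qed

text \<open>Greedy counterpart of drawing \<open>m\<close> random points: by double counting, some
  point of \<open>U\<close> lies in at least an \<open>\<eta>\<close> fraction of the sets still
  missed, so each added point shrinks their number by the factor \<open>1 - \<eta>\<close>.\<close>

lemma ex_small_set_meeting_most:
  fixes \<eta> :: real
  assumes "finite U" "U \<noteq> {}" "finite P" "\<eta> \<le> 1"
    and "\<And>p. p \<in> P \<Longrightarrow> D p \<subseteq> U" and "\<And>p. p \<in> P \<Longrightarrow> \<eta> * card U \<le> card (D p)"
  shows "\<exists>A\<subseteq>U. card A \<le> m \<and> card {p\<in>P. D p \<inter> A = {}} \<le> (1 - \<eta>) ^ m * card P"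
proof (induction m)
  case 0
  then show ?case by (intro exI[of _ "{}"]) auto
next
  case (Suc m)
  then obtain A where A: "A \<subseteq> U" "card A \<le> m"
    "card {p\<in>P. D p \<inter> A = {}} \<le> (1 - \<eta>) ^ m * card P" by blast
  define P' where "P' = {p\<in>P. D p \<inter> A = {}}"
  have fP': "finite P'" using assms by (simp add: P'_def)
  have "\<exists>u\<in>U. \<eta> * card P' \<le> card {p\<in>P'. u \<in> D p}"
  proof (rule ccontr)
    assume "\<not> ?thesis"
    then have *: "\<And>u. u \<in> U \<Longrightarrow> card {p\<in>P'. u \<in> D p} < \<eta> * card P'" by force
    have "\<eta> * card U * card P' = (\<Sum>p\<in>P'. \<eta> * card U)" by simp
    also have "\<dots> \<le> (\<Sum>p\<in>P'. real (card (D p)))"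
      using assms by (intro sum_mono) (auto simp: P'_def)
    also have "\<dots> = (\<Sum>p\<in>P'. \<Sum>u\<in>U. if u \<in> D p then 1 else 0)"
    proof (rule sum.cong[OF refl])
      fix p assume "p \<in> P'"
      then have "U \<inter> {u. u \<in> D p} = D p" using assms(5) by (auto simp: P'_def)
      then show "real (card (D p)) = (\<Sum>u\<in>U. if u \<in> D p then 1 else 0)"
        using assms(1) by (simp flip: sum.inter_restrict)
    qed
    also have "\<dots> = (\<Sum>u\<in>U. \<Sum>p\<in>P'. if u \<in> D p then 1 else 0)" by (rule sum.swap)
    also have "\<dots> = (\<Sum>u\<in>U. real (card {p\<in>P'. u \<in> D p}))"
      using fP' by (intro sum.cong refl) (simp flip: sum.inter_filter)
    also have "\<dots> < (\<Sum>u\<in>U. \<eta> * card P')" using assms * by (intro sum_strict_mono) auto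
    also have "\<dots> = \<eta> * card U * card P'" by simp
    finally show False by simp
  qed
  then obtain u where u: "u \<in> U" "\<eta> * card P' \<le> card {p\<in>P'. u \<in> D p}" by blast
  have le: "card {p\<in>P'. u \<in> D p} \<le> card P'" using fP' by (intro card_mono) auto
  have "{p\<in>P. D p \<inter> insert u A = {}} = P' - {p\<in>P'. u \<in> D p}" by (auto simp: P'_def)
  then have "real (card {p\<in>P. D p \<inter> insert u A = {}}) = real (card P') - real (card {p\<in>P'. u \<in> D p})"
    using fP' le by (simp add: card_Diff_subset of_nat_diff)
  also have "\<dots> \<le> (1 - \<eta>) * card P'" using u by (simp add: algebra_simps)
  also have "\<dots> \<le> (1 - \<eta>) * ((1 - \<eta>) ^ m * card P)"
    using A(3) assms(4) unfolding P'_def by (intro mult_left_mono) auto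
  finally have "real (card {p\<in>P. D p \<inter> insert u A = {}}) \<le> (1 - \<eta>) ^ Suc m * card P" by simp
  moreover have "card (insert u A) \<le> Suc m"
    using A assms(1) by (metis card_insert_le_m1 diff_Suc_1 zero_less_Suc)
  ultimately show ?case using A u by (intro exI[of _ "insert u A"]) auto
qed

text \<open>A packing bound in the style of Haussler. Some \<open>m\<close> points miss fewer than
  one of the differences, hence none, so the sets have distinct traces on these points, and the
  shattering lemma counts the traces. Differences in one direction suffice for distinctness.\<close>

lemma separated_sets_bound:
  fixes \<eta> :: real and R :: "nat \<Rightarrow> 'a set"
  assumes "finite U" "U \<noteq> {}" "\<eta> \<le> 1"
    and sub: "\<And>s. s < M \<Longrightarrow> R s \<subseteq> U"
    and sep: "\<And>s t. s < t \<Longrightarrow> t < M \<Longrightarrow> \<eta> * card U \<le> card (R s - R t)"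
    and vc: "\<And>S. finite S \<Longrightarrow> shatters (R ` {..<M}) S \<Longrightarrow> card S \<le> D"
    and small: "real M ^ 2 * (1 - \<eta>) ^ m < 1"
  shows "M \<le> (m + 1) ^ D"
proof -
  define P where "P = {(s, t). s < t \<and> t < M}"
  have sub': "P \<subseteq> {..<M} \<times> {..<M}" by (auto simp: P_def)
  then have fP: "finite P" by (rule finite_subset) auto
  have cP: "card P \<le> M ^ 2"
    using card_mono[OF _ sub'] by (simp add: card_cartesian_product power2_eq_square)
  obtain A where A: "A \<subseteq> U" "card A \<le> m"
    "card {p\<in>P. (R (fst p) - R (snd p)) \<inter> A = {}} \<le> (1 - \<eta>) ^ m * card P"
  proof -
    have "R (fst p) - R (snd p) \<subseteq> U" if "p \<in> P" for p
      using sub[of "fst p"] that by (auto simp: P_def)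
    moreover have "\<eta> * card U \<le> card (R (fst p) - R (snd p))" if "p \<in> P" for p
      using sep[of "fst p" "snd p"] that by (auto simp: P_def)
    ultimately show thesis
      using that ex_small_set_meeting_most[OF assms(1,2) fP assms(3), of "\<lambda>p. R (fst p) - R (snd p)" m]
      by blast
  qed
  have fA: "finite A" using A assms finite_subset by blast
  have "(1 - \<eta>) ^ m * card P \<le> (1 - \<eta>) ^ m * real (M ^ 2)"
    using cP \<open>\<eta> \<le> 1\<close> by (intro mult_left_mono) (simp_all only: of_nat_le_iff, simp)
  then have "real (card {p\<in>P. (R (fst p) - R (snd p)) \<inter> A = {}}) < 1"
    using A(3) small by (simp add: mult.commute)
  then have "{p\<in>P. (R (fst p) - R (snd p)) \<inter> A = {}} = {}" using fP by simp
  then have ne: "(R s - R t) \<inter> A \<noteq> {}" if "s < t" "t < M" for s t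
    using that by (auto simp: P_def)
  have inj: "inj_on (\<lambda>s. R s \<inter> A) {..<M}"
  proof (rule linorder_inj_onI)
    fix s t assume "s < t" "s \<in> {..<M}" "t \<in> {..<M}"
    then have "(R s - R t) \<inter> A \<noteq> {}" using ne by blast
    then show "R s \<inter> A \<noteq> R t \<inter> A" by blast
  qed auto
  let ?\<A> = "(\<lambda>s. R s \<inter> A) ` {..<M}"
  have "M = card ?\<A>" using inj by (simp add: card_image)
  also have "\<dots> \<le> card {S\<in>Pow A. shatters ?\<A> S}" by (rule card_le_card_shattered[OF fA]) auto
  also have "\<dots> \<le> card {S. S \<subseteq> A \<and> card S \<le> D}"
  proof (rule card_mono)
    show "{S \<in> Pow A. shatters ?\<A> S} \<subseteq> {S. S \<subseteq> A \<and> card S \<le> D}"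
    proof safe
      fix S assume S: "S \<subseteq> A" "shatters ?\<A> S"
      have "shatters (R ` {..<M}) S"
        unfolding shatters_def
      proof (intro allI impI)
        fix T assume "T \<subseteq> S"
        then obtain s where "s < M" "R s \<inter> A \<inter> S = T" using S unfolding shatters_def by blast
        then show "\<exists>A\<in>R ` {..<M}. A \<inter> S = T" using S by (intro bexI[of _ "R s"]) auto
      qed
      then show "card S \<le> D" using vc S fA finite_subset by blast
    qed
  qed (use fA in auto)
  also have "\<dots> \<le> (card A + 1) ^ D" by (rule card_subsets_card_le[OF fA])
  also have "\<dots> \<le> (m + 1) ^ D" using A by (intro power_mono) auto
  finally show ?thesis .
qed

section \<open>Weights\<close>

lemma sum_UNION_le:
  fixes w :: "'b \<Rightarrow> real"
  assumes "finite I" "\<And>i. i \<in> I \<Longrightarrow> finite (A i)" "\<And>i x. i \<in> I \<Longrightarrow> x \<in> A i \<Longrightarrow> 0 \<le> w x"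
  shows "sum w (\<Union>i\<in>I. A i) \<le> (\<Sum>i\<in>I. sum w (A i))"
  using assms
proof (induction I rule: finite_induct)
  case (insert i I)
  have "0 \<le> sum w (A i \<inter> (\<Union>i\<in>I. A i))" using insert.prems by (intro sum_nonneg) auto
  moreover have "sum w (A i \<union> (\<Union>i\<in>I. A i)) =
      sum w (A i) + sum w (\<Union>i\<in>I. A i) - sum w (A i \<inter> (\<Union>i\<in>I. A i))"
    using insert by (intro sum_Un) auto
  moreover have "sum w (\<Union>i\<in>I. A i) \<le> (\<Sum>i\<in>I. sum w (A i))" using insert by auto
  ultimately show ?case using insert.hyps by simp
qed simp

text \<open>Potential argument: each chosen \<open>s\<close> halves the weight of the elements that
  it hits. As it hits more than an \<open>\<epsilon>\<close> share, the total falls by the factor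
  \<open>1 - \<epsilon> / 2\<close>, whereas an element hit \<open>c\<close> times keeps weight
  \<open>(1/2) ^ c\<close>. An element hit too rarely would outweigh the total.\<close>

lemma multiplicative_weights:
  fixes \<epsilon> :: real
  assumes "finite F" "F \<noteq> {}" "0 < \<epsilon>" "\<epsilon> \<le> 1"
    and heavy: "\<And>w. (\<And>x. x \<in> F \<Longrightarrow> 0 \<le> w x) \<Longrightarrow> sum w F = 1 \<Longrightarrow>
      \<exists>s\<in>\<S>. \<epsilon> < sum w {x\<in>F. h s x}"
  shows "\<exists>T>0. \<exists>L::nat \<Rightarrow> 's. (\<forall>t<T. L t \<in> \<S>) \<and>
    (\<forall>x\<in>F. \<epsilon> / 4 * real T \<le> card {t. t < T \<and> h (L t) x})"
proof -
  have ex: "\<exists>L::nat \<Rightarrow> 's. (\<forall>t<T. L t \<in> \<S>) \<and>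
    (\<Sum>x\<in>F. (1/2::real) ^ card {t. t < T \<and> h (L t) x}) \<le> card F * (1 - \<epsilon> / 2) ^ T" for T
  proof (induction T)
    case 0
    then show ?case by simp
  next
    case (Suc T)
    then obtain L :: "nat \<Rightarrow> 's" where L: "\<And>t. t < T \<Longrightarrow> L t \<in> \<S>"
      "(\<Sum>x\<in>F. (1/2::real) ^ card {t. t < T \<and> h (L t) x}) \<le> card F * (1 - \<epsilon> / 2) ^ T" by blast
    define w where "w x = (1/2::real) ^ card {t. t < T \<and> h (L t) x}" for x
    define W where "W = sum w F"
    have Wpos: "W > 0" unfolding W_def using assms by (intro sum_pos) (auto simp: w_def)
    have "\<exists>s\<in>\<S>. \<epsilon> < (\<Sum>x\<in>{x\<in>F. h s x}. w x / W)"
      using Wpos by (intro heavy) (auto simp: w_def W_def simp flip: sum_divide_distrib)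
    then obtain s where s: "s \<in> \<S>" "\<epsilon> < sum w {x\<in>F. h s x} / W"
      by (auto simp flip: sum_divide_distrib)
    have s': "\<epsilon> * W \<le> sum w {x\<in>F. h s x}" using s Wpos by (simp add: field_simps)
    define L' where "L' = L(T := s)"
    have card: "card {t. t < Suc T \<and> h (L' t) x} =
        (if h s x then Suc (card {t. t < T \<and> h (L t) x}) else card {t. t < T \<and> h (L t) x})" for x
    proof -
      have "{t. t < Suc T \<and> h (L' t) x} =
          (if h s x then insert T {t. t < T \<and> h (L t) x} else {t. t < T \<and> h (L t) x})"
        by (auto simp: L'_def less_Suc_eq)
      then show ?thesis by simp
    qed
    have "(\<Sum>x\<in>F. (1/2::real) ^ card {t. t < Suc T \<and> h (L' t) x}) =
        (\<Sum>x\<in>F. w x - (if h s x then w x / 2 else 0))"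
      by (intro sum.cong refl) (simp add: card w_def)
    also have "\<dots> = W - sum w {x\<in>F. h s x} / 2"
      using assms by (simp add: sum_subtractf W_def sum_divide_distrib flip: sum.inter_filter)
    also have "\<dots> \<le> (1 - \<epsilon> / 2) * W" using s' by (simp add: algebra_simps)
    also have "\<dots> \<le> (1 - \<epsilon> / 2) * (card F * (1 - \<epsilon> / 2) ^ T)"
      using L(2) assms by (intro mult_left_mono) (auto simp: W_def w_def)
    finally have "(\<Sum>x\<in>F. (1/2::real) ^ card {t. t < Suc T \<and> h (L' t) x})
        \<le> card F * (1 - \<epsilon> / 2) ^ Suc T" by (simp add: mult_ac)
    then show ?case using L(1) s(1) by (intro exI[of _ L']) (auto simp: L'_def less_Suc_eq)
  qed
  \<comment> \<open>For this \<open>T\<close> the initial total \<open>card F\<close> is at most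
    \<open>exp (\<epsilon> / 4 * T)\<close>, which uses up half of the decay exponent
    \<open>\<epsilon> / 2 * T\<close>; the other half bounds \<open>c\<close>. The
    \<open>+ 1\<close> keeps \<open>T\<close> positive when \<open>card F = 1\<close>.\<close>
  define T where "T = nat \<lceil>4 / \<epsilon> * ln (card F)\<rceil> + 1"
  have cF: "card F \<ge> 1" using assms by (simp add: Suc_leI card_gt_0_iff)
  have "4 / \<epsilon> * ln (card F) \<le> T" unfolding T_def by linarith
  then have T: "ln (card F) \<le> \<epsilon> / 4 * T" using assms by (simp add: field_simps)
  obtain L :: "nat \<Rightarrow> 's" where L: "\<And>t. t < T \<Longrightarrow> L t \<in> \<S>"
      "(\<Sum>x\<in>F. (1/2::real) ^ card {t. t < T \<and> h (L t) x}) \<le> card F * (1 - \<epsilon> / 2) ^ T"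
    using ex[of T] by blast
  have "\<epsilon> / 4 * real T \<le> card {t. t < T \<and> h (L t) x}" if "x \<in> F" for x
  proof -
    define c where "c = card {t. t < T \<and> h (L t) x}"
    have "(1/2) ^ c \<le> (\<Sum>x\<in>F. (1/2::real) ^ card {t. t < T \<and> h (L t) x})"
      unfolding c_def using assms that by (intro member_le_sum) auto
    also have "\<dots> \<le> card F * (1 - \<epsilon> / 2) ^ T" by (rule L)
    also have "\<dots> \<le> exp (\<epsilon> / 4 * T) * exp (- \<epsilon> / 2) ^ T"
    proof (intro mult_mono power_mono)
      show "real (card F) \<le> exp (\<epsilon> / 4 * T)"
        using T cF by (metis exp_le_cancel_iff exp_ln of_nat_0_less_iff less_le_trans zero_less_one)
      show "1 - \<epsilon> / 2 \<le> exp (- \<epsilon> / 2)" using exp_ge_add_one_self[of "- \<epsilon> / 2"] by simp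
    qed (use assms in auto)
    also have "\<dots> = exp (- (\<epsilon> / 4 * T))"
      by (simp flip: exp_add exp_of_nat_mult add: algebra_simps)
    finally have "(1/2) ^ c \<le> exp (- (\<epsilon> / 4 * T))" .
    moreover have "exp (- real c) \<le> (1/2::real) ^ c"
    proof -
      have "exp (- 1::real) \<le> 1 / 2"
        using exp_ge_add_one_self[of "1::real"] by (simp add: exp_minus field_simps)
      then have "exp (- 1::real) ^ c \<le> (1 / 2) ^ c" by (intro power_mono) auto
      then show ?thesis by (simp flip: exp_of_nat_mult)
    qed
    ultimately show ?thesis unfolding c_def[symmetric] by (metis exp_le_cancel_iff neg_le_iff_le order_trans)
  qed
  then show ?thesis using L(1) by (intro exI[of _ T]) (auto simp: T_def)
qed

text \<open>Union bound for the product measure with factors \<open>\<mu> i\<close>. By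
  \<open>indep\<close> the set \<open>bad \<kappa> f\<close> ignores coordinate
  \<open>a \<kappa>\<close>; with the other coordinates fixed it is a fixed set of mass at most
  \<open>\<delta>\<close>, and averaging over them keeps this bound.\<close>

lemma ex_choice_avoiding:
  fixes \<mu> :: "'i \<Rightarrow> 'b \<Rightarrow> real" and \<delta> :: real
  assumes "finite I" and G: "\<And>i. i \<in> I \<Longrightarrow> finite (G i)"
    and \<mu>: "\<And>i x. i \<in> I \<Longrightarrow> x \<in> G i \<Longrightarrow> 0 \<le> \<mu> i x" "\<And>i. i \<in> I \<Longrightarrow> sum (\<mu> i) (G i) = 1"
    and "finite K" and aI: "\<And>\<kappa>. \<kappa> \<in> K \<Longrightarrow> a \<kappa> \<in> I"
    and indep: "\<And>\<kappa> f y. \<kappa> \<in> K \<Longrightarrow> bad \<kappa> (f(a \<kappa> := y)) = bad \<kappa> f"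
    and mass: "\<And>\<kappa> f. \<kappa> \<in> K \<Longrightarrow> sum (\<mu> (a \<kappa>)) (G (a \<kappa>) \<inter> bad \<kappa> f) \<le> \<delta>"
    and "card K * \<delta> < 1"
  shows "\<exists>f\<in>PiE I G. \<forall>\<kappa>\<in>K. f (a \<kappa>) \<notin> bad \<kappa> f"
proof (rule ccontr)
  assume "\<not> ?thesis"
  then have *: "\<exists>\<kappa>\<in>K. f (a \<kappa>) \<in> bad \<kappa> f" if "f \<in> PiE I G" for f using that by blast
  let ?w = "\<lambda>f. \<Prod>i\<in>I. \<mu> i (f i)"
  have total: "(\<Sum>f\<in>PiE J G. \<Prod>i\<in>J. \<mu> i (f i)) = 1" if "J \<subseteq> I" for J
  proof -
    have "(\<Sum>f\<in>PiE J G. \<Prod>i\<in>J. \<mu> i (f i)) = (\<Prod>i\<in>J. sum (\<mu> i) (G i))"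
      using that \<open>finite I\<close> G by (subst prod_sum_PiE) (auto intro: finite_subset)
    also have "\<dots> = 1" using that \<mu>(2) by (intro prod.neutral) auto
    finally show ?thesis .
  qed
  have bound: "(\<Sum>f\<in>PiE I G. if f (a \<kappa>) \<in> bad \<kappa> f then ?w f else 0) \<le> \<delta>" if \<kappa>: "\<kappa> \<in> K" for \<kappa>
  proof -
    define J where "J = I - {a \<kappa>}"
    have I: "I = insert (a \<kappa>) J" "a \<kappa> \<notin> J" "finite J" using aI[OF \<kappa>] \<open>finite I\<close> by (auto simp: J_def)
    let ?v = "\<lambda>g. \<Prod>i\<in>J. \<mu> i (g i)"
    have "(\<Sum>f\<in>PiE I G. if f (a \<kappa>) \<in> bad \<kappa> f then ?w f else 0) =
       (\<Sum>(y, g)\<in>G (a \<kappa>) \<times> PiE J G. if y \<in> bad \<kappa> g then \<mu> (a \<kappa>) y * ?v g else 0)"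
      unfolding I(1) PiE_insert_eq
    proof (subst sum.reindex)
      show "inj_on (\<lambda>(y, g). g(a \<kappa> := y)) (G (a \<kappa>) \<times> Pi\<^sub>E J G)" using I(2) by (rule inj_combinator)
      show "sum ((\<lambda>f. if f (a \<kappa>) \<in> bad \<kappa> f then \<Prod>i\<in>insert (a \<kappa>) J. \<mu> i (f i) else 0) \<circ>
          (\<lambda>(y, g). g(a \<kappa> := y))) (G (a \<kappa>) \<times> Pi\<^sub>E J G) =
        (\<Sum>(y, g)\<in>G (a \<kappa>) \<times> PiE J G. if y \<in> bad \<kappa> g then \<mu> (a \<kappa>) y * ?v g else 0)"
      proof (rule sum.cong[OF refl], safe)
        fix y g
        have "(\<Prod>i\<in>J. \<mu> i ((g(a \<kappa> := y)) i)) = ?v g" using I(2) by (intro prod.cong) auto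
        then show "((\<lambda>f. if f (a \<kappa>) \<in> bad \<kappa> f then \<Prod>i\<in>insert (a \<kappa>) J. \<mu> i (f i) else 0) \<circ>
          (\<lambda>(y, g). g(a \<kappa> := y))) (y, g) = (if y \<in> bad \<kappa> g then \<mu> (a \<kappa>) y * ?v g else 0)"
          using I indep[OF \<kappa>] by simp
      qed
    qed
    also have "\<dots> = (\<Sum>g\<in>PiE J G. \<Sum>y\<in>G (a \<kappa>). if y \<in> bad \<kappa> g then \<mu> (a \<kappa>) y * ?v g else 0)"
      by (simp flip: sum.cartesian_product) (rule sum.swap)
    also have "\<dots> = (\<Sum>g\<in>PiE J G. ?v g * sum (\<mu> (a \<kappa>)) (G (a \<kappa>) \<inter> bad \<kappa> g))"
      using G[OF aI[OF \<kappa>]]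
      by (intro sum.cong refl) (simp add: sum_distrib_left sum.inter_restrict mult.commute if_distrib cong: if_cong)
    also have "\<dots> \<le> (\<Sum>g\<in>PiE J G. ?v g * \<delta>)"
      using mass[OF \<kappa>] \<mu>(1) by (intro sum_mono mult_left_mono prod_nonneg) (auto simp: I(1) PiE_mem)
    also have "\<dots> = \<delta>" using total[of J] by (simp add: J_def flip: sum_distrib_right)
    finally show ?thesis .
  qed
  have "1 = (\<Sum>f\<in>PiE I G. ?w f)" using total[of I] by simp
  also have "\<dots> \<le> (\<Sum>f\<in>PiE I G. \<Sum>\<kappa>\<in>K. if f (a \<kappa>) \<in> bad \<kappa> f then ?w f else 0)"
  proof (rule sum_mono)
    fix f assume f: "f \<in> PiE I G"
    obtain \<kappa> where \<kappa>: "\<kappa> \<in> K" "f (a \<kappa>) \<in> bad \<kappa> f" using *[OF f] by blast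
    have nn: "0 \<le> ?w f" using f \<mu>(1) by (intro prod_nonneg) (auto simp: PiE_mem)
    have "?w f = (if f (a \<kappa>) \<in> bad \<kappa> f then ?w f else 0)" using \<kappa> by simp
    also have "\<dots> \<le> (\<Sum>\<kappa>\<in>K. if f (a \<kappa>) \<in> bad \<kappa> f then ?w f else 0)"
      using \<kappa>(1) \<open>finite K\<close> nn by (intro member_le_sum[of \<kappa>]) auto
    finally show "?w f \<le> (\<Sum>\<kappa>\<in>K. if f (a \<kappa>) \<in> bad \<kappa> f then ?w f else 0)" .
  qed
  also have "\<dots> = (\<Sum>\<kappa>\<in>K. \<Sum>f\<in>PiE I G. if f (a \<kappa>) \<in> bad \<kappa> f then ?w f else 0)" by (rule sum.swap)
  also have "\<dots> \<le> (\<Sum>\<kappa>\<in>K. \<delta>)" by (intro sum_mono bound)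
  also have "\<dots> < 1" using \<open>card K * \<delta> < 1\<close> by simp
  finally show False by simp
qed

section \<open>Nets for half-spaces\<close>

text \<open>By Helly: at most \<open>DIM('e) + 1\<close> sets \<open>A - B\<close>, each below a
  \<open>1 / (DIM('e) + 1)\<close> fraction of \<open>A\<close>, cannot cover \<open>A\<close>, so
  the corresponding \<open>B\<close> share an index. Working with indices counts points with
  multiplicity.\<close>

lemma ex_centerpoint:
  fixes \<phi> :: "'i \<Rightarrow> 'e::euclidean_space"
  assumes "finite A" "A \<noteq> {}"
  shows "\<exists>z. \<forall>B\<subseteq>A. (DIM('e) + 1) * card (A - B) < card A \<longrightarrow> z \<in> convex hull (\<phi> ` B)"
proof -
  define \<B> where "\<B> = {B. B \<subseteq> A \<and> (DIM('e) + 1) * card (A - B) < card A}"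
  define \<F> where "\<F> = (\<lambda>B. convex hull (\<phi> ` B)) ` \<B>"
  have fin: "finite \<F>" using assms by (simp add: \<F>_def \<B>_def)
  have small: "\<Inter>\<G> \<noteq> {}" if \<G>: "\<G> \<subseteq> \<F>" "card \<G> \<le> DIM('e) + 1" for \<G>
  proof -
    have f\<G>: "finite \<G>" using \<G> fin finite_subset by blast
    \<comment> \<open>One index set is kept per hull, so that the bound on \<open>card \<G>\<close>
      also bounds the number of index sets.\<close>
    obtain \<C> where "\<C> \<subseteq> \<B>" "inj_on (\<lambda>B. convex hull (\<phi> ` B)) \<C>" "\<G> = (\<lambda>B. convex hull (\<phi> ` B)) ` \<C>"
      using \<G>(1) unfolding \<F>_def by (meson subset_image_inj)
    then have \<C>: "\<C> \<subseteq> \<B>" "finite \<C>" "card \<C> = card \<G>" "\<G> = (\<lambda>B. convex hull (\<phi> ` B)) ` \<C>"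
      using f\<G> by (auto simp: card_image finite_image_iff)
    have "\<exists>x\<in>A. \<forall>B\<in>\<C>. x \<in> B"
    proof (rule ccontr)
      assume "\<not> ?thesis"
      then have "A \<subseteq> (\<Union>B\<in>\<C>. A - B)" by blast
      then have "card A \<le> card (\<Union>B\<in>\<C>. A - B)" using \<C> assms by (intro card_mono) auto
      also have "\<dots> \<le> (\<Sum>B\<in>\<C>. card (A - B))" by (rule card_UN_le[OF \<C>(2)])
      finally have le: "card A \<le> (\<Sum>B\<in>\<C>. card (A - B))" .
      have "\<C> \<noteq> {}" using le assms by auto
      have "(DIM('e) + 1) * card A \<le> (\<Sum>B\<in>\<C>. (DIM('e) + 1) * card (A - B))"
        unfolding sum_distrib_left[symmetric] using le by (rule mult_le_mono2)
      also have "\<dots> < (\<Sum>B\<in>\<C>. card A)"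
        using \<C> \<open>\<C> \<noteq> {}\<close> by (intro sum_strict_mono) (auto simp: \<B>_def)
      also have "\<dots> \<le> (DIM('e) + 1) * card A"
        unfolding sum_constant \<C>(3) of_nat_id using \<G>(2) by (rule mult_le_mono1)
      finally show False by simp
    qed
    then obtain x where "\<forall>B\<in>\<C>. x \<in> B" by blast
    then have "\<phi> x \<in> \<Inter>\<G>" unfolding \<C>(4) by (auto intro: hull_inc)
    then show ?thesis by blast
  qed
  have "\<Inter>\<F> \<noteq> {}"
  \<comment> \<open>Helly's theorem asks for at least \<open>DIM('e) + 1\<close> sets; smaller
    families are covered by \<open>small\<close> itself.\<close>
  proof (cases "card \<F> \<le> DIM('e) + 1")
    case True
    then show ?thesis using small by blast
  next
    case False
    show ?thesis
    proof (rule Helly)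
      show "\<forall>S\<in>\<F>. convex S" by (auto simp: \<F>_def)
    qed (use False small in auto)
  qed
  then show ?thesis by (auto simp: \<F>_def \<B>_def)
qed

text \<open>Caratheodory puts the centre point \<open>z\<close> into the hull of few of the points.
  If \<open>H\<close> missed all of these, \<open>z\<close> would lie in the convex set
  \<open>- H\<close>; but \<open>H\<close> contains so many points that \<open>z\<close> lies in
  \<open>H\<close>.\<close>

lemma ex_center_net:
  fixes \<phi> :: "'i \<Rightarrow> 'e::euclidean_space"
  assumes "finite A" "A \<noteq> {}"
  shows "\<exists>Z\<subseteq>A. card Z \<le> DIM('e) + 1 \<and> (\<forall>H. convex H \<and> convex (- H) \<and>
    (DIM('e) + 1) * card {t\<in>A. \<phi> t \<notin> H} < card A \<longrightarrow> (\<exists>t\<in>Z. \<phi> t \<in> H))"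
proof -
  obtain z where z: "\<And>B. B \<subseteq> A \<Longrightarrow> (DIM('e) + 1) * card (A - B) < card A \<Longrightarrow> z \<in> convex hull (\<phi> ` B)"
    using ex_centerpoint[OF assms, of \<phi>] by blast
  have "z \<in> convex hull (\<phi> ` A)" using z[of A] assms by (simp add: card_gt_0_iff)
  then obtain S where S: "finite S" "S \<subseteq> \<phi> ` A" "card S \<le> DIM('e) + 1" "z \<in> convex hull S"
    unfolding caratheodory[of "\<phi> ` A"] by blast
  then obtain Z where Z: "Z \<subseteq> A" "inj_on \<phi> Z" "S = \<phi> ` Z" by (meson subset_image_inj)
  have "\<exists>t\<in>Z. \<phi> t \<in> H" if H: "convex H" "convex (- H)"
    "(DIM('e) + 1) * card {t\<in>A. \<phi> t \<notin> H} < card A" for H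
  proof (rule ccontr)
    assume "\<not> ?thesis"
    then have "S \<subseteq> - H" using Z by auto
    then have "z \<notin> H" using S(4) H(2) hull_minimal[of S "- H" convex] by blast
    have "A - {t\<in>A. \<phi> t \<in> H} = {t\<in>A. \<phi> t \<notin> H}" by auto
    then have "z \<in> convex hull (\<phi> ` {t\<in>A. \<phi> t \<in> H})" using z[of "{t\<in>A. \<phi> t \<in> H}"] H(3) by auto
    also have "\<dots> \<subseteq> H" using H(1) by (intro hull_minimal) auto
    finally show False using \<open>z \<notin> H\<close> by blast
  qed
  moreover have "card Z \<le> DIM('e) + 1" using S Z by (simp add: card_image)
  ultimately show ?thesis using Z(1) by blast
qed

text \<open>Radon: a larger set of points splits into two parts with intersecting hulls, and no
  convex set with convex complement can cut off exactly one part.\<close>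

lemma card_shattered_le_DIM:
  fixes \<phi> :: "'i \<Rightarrow> 'e::euclidean_space"
  assumes "\<And>H. H \<in> \<H> \<Longrightarrow> convex H \<and> convex (- H)"
    and "finite S" and "shatters ((\<lambda>H. {t\<in>U. \<phi> t \<in> H}) ` \<H>) S"
  shows "card S \<le> DIM('e) + 1"
proof (rule ccontr)
  assume big: "\<not> ?thesis"
  have sh: "\<exists>H\<in>\<H>. \<forall>t\<in>S. t \<in> T \<longleftrightarrow> t \<in> U \<and> \<phi> t \<in> H" if "T \<subseteq> S" for T
    using assms(3) that unfolding shatters_def by blast
  have SU: "S \<subseteq> U" using sh[of S] by blast
  have "inj_on \<phi> S"
  proof (rule inj_onI)
    fix s t assume st: "s \<in> S" "t \<in> S" "\<phi> s = \<phi> t"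
    obtain H where "\<forall>u\<in>S. u \<in> {s} \<longleftrightarrow> u \<in> U \<and> \<phi> u \<in> H" using sh[of "{s}"] st by auto
    then show "s = t" using st SU by (metis singletonD singletonI subsetD)
  qed
  then have "card (\<phi> ` S) \<ge> DIM('e) + 2" using big by (simp add: card_image)
  then have "affine_dependent (\<phi> ` S)" using \<open>finite S\<close> by (intro affine_dependent_biggerset) auto
  then obtain M P where MP: "M \<inter> P = {}" "M \<union> P = \<phi> ` S" "convex hull M \<inter> convex hull P \<noteq> {}"
    using Radon_partition[of "\<phi> ` S"] \<open>finite S\<close> by blast
  obtain H where H: "H \<in> \<H>" "\<forall>t\<in>S. t \<in> {t\<in>S. \<phi> t \<in> M} \<longleftrightarrow> t \<in> U \<and> \<phi> t \<in> H"
    using sh[of "{t\<in>S. \<phi> t \<in> M}"] by auto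
  have "x \<in> H" if "x \<in> M" for x using that MP(2) H(2) by (metis (mono_tags, lifting) UnI1 imageE mem_Collect_eq)
  moreover have "x \<in> - H" if x: "x \<in> P" for x
  proof -
    obtain t where "t \<in> S" "x = \<phi> t" using x MP(2) by blast
    then show ?thesis using x MP(1) H(2) SU by auto
  qed
  ultimately have "convex hull M \<subseteq> H" "convex hull P \<subseteq> - H"
    using assms(1)[OF H(1)] hull_minimal[of M H convex] hull_minimal[of P "- H" convex]
    by (meson subsetI)+
  then show False using MP(3) by blast
qed

text \<open>As long as the net misses some \<open>H\<close>, add a centre net for the points in \<open>H\<close>. Every later
  set that misses the net then misses a fixed fraction of the points in \<open>H\<close>, so the sets picked
  are separated and their number is bounded.\<close>

lemma ex_halfspace_net:
  fixes \<delta> :: real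
  assumes "0 < \<delta>" "\<delta> \<le> 1"
  shows "\<exists>C. \<forall>(\<phi> :: nat \<Rightarrow> 'e::euclidean_space) T \<H>. 0 < T \<longrightarrow>
    (\<forall>H\<in>\<H>. convex H \<and> convex (- H) \<and> \<delta> * real T \<le> card {t. t < T \<and> \<phi> t \<in> H}) \<longrightarrow>
    (\<exists>Z\<subseteq>{..<T}. card Z \<le> C \<and> (\<forall>H\<in>\<H>. \<exists>t\<in>Z. \<phi> t \<in> H))"
proof -
  define D where "D = DIM('e) + 1"
  \<comment> \<open>A set that misses a centre net misses at least a \<open>1 / D\<close> fraction
    of the points the net was built for, and those make up at least a \<open>\<delta>\<close>
    fraction of all points.\<close>
  define \<eta> where "\<eta> = \<delta> / D"
  have D: "D \<ge> 1" by (simp add: D_def)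
  have \<eta>: "0 < \<eta>" "\<eta> \<le> 1" using assms D by (auto simp: \<eta>_def divide_simps)
  have "\<forall>\<^sub>F m::nat in sequentially. (real ((m + 1) ^ D + 1))\<^sup>2 * (1 - \<eta>) ^ m < 1"
  proof -
    have "((\<lambda>m::nat. ((real m + 1) powr d + 1)\<^sup>2 * exp (- \<eta> * real m)) \<longlongrightarrow> 0) sequentially"
      if "0 < d" for d using \<open>0 < \<eta>\<close> that by real_asymp
    from this[of "real D"] have "((\<lambda>m::nat. ((real m + 1) powr real D + 1)\<^sup>2 * exp (- \<eta> * real m)) \<longlongrightarrow> 0) sequentially"
      using D by simp
    then have "\<forall>\<^sub>F m::nat in sequentially. ((real m + 1) powr real D + 1)\<^sup>2 * exp (- \<eta> * real m) < 1"
      by (rule order_tendstoD) simp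
    then show ?thesis
    proof eventually_elim
      case (elim m)
      have "(1 - \<eta>) ^ m \<le> exp (- \<eta>) ^ m"
        using exp_ge_add_one_self[of "- \<eta>"] \<eta> by (intro power_mono) auto
      also have "\<dots> = exp (- \<eta> * real m)" by (simp flip: exp_of_nat_mult add: mult.commute)
      finally have "(real ((m + 1) ^ D + 1))\<^sup>2 * (1 - \<eta>) ^ m \<le> (real ((m + 1) ^ D + 1))\<^sup>2 * exp (- \<eta> * real m)"
        by (intro mult_left_mono) auto
      also have "\<dots> < 1" using elim by (simp add: powr_realpow add_ac)
      finally show ?case .
    qed
  qed
  then obtain m :: nat where m: "(real ((m + 1) ^ D + 1))\<^sup>2 * (1 - \<eta>) ^ m < 1"
    using eventually_happens' sequentially_bot by blast
  \<comment> \<open>One more than the packing bound: \<open>M\<close> separated sets cannot exist,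
    so the process must have produced a net with at most \<open>M * D\<close> points.\<close>
  define M where "M = (m + 1) ^ D + 1"
  have main: "\<exists>Z\<subseteq>{..<T}. card Z \<le> M * D \<and> (\<forall>H\<in>\<H>. \<exists>t\<in>Z. \<phi> t \<in> H)"
    if "0 < T" and \<H>: "\<And>H. H \<in> \<H> \<Longrightarrow> convex H \<and> convex (- H) \<and> \<delta> * real T \<le> card {t. t < T \<and> \<phi> t \<in> H}"
    for \<phi> :: "nat \<Rightarrow> 'e" and T \<H>
  proof (rule ccontr)
    assume none: "\<not> ?thesis"
    define R where "R H = {t. t < T \<and> \<phi> t \<in> H}" for H
    \<comment> \<open>The last conjunct carries the induction: whatever misses \<open>Z\<close> is
      already separated from every set picked so far, so any such set may be picked next.\<close>
    have step: "\<exists>h Z. (\<forall>s<n. h s \<in> \<H>) \<and> (\<forall>t<n. \<forall>s<t. \<eta> * T \<le> card (R (h s) - R (h t))) \<and>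
        Z \<subseteq> {..<T} \<and> card Z \<le> n * D \<and>
        (\<forall>H\<in>\<H>. (\<exists>t\<in>Z. \<phi> t \<in> H) \<or> (\<forall>s<n. \<eta> * T \<le> card (R (h s) - R H)))"
      if "n \<le> M" for n
      using that
    proof (induction n)
      case 0
      show ?case by (rule exI[of _ undefined], rule exI[of _ "{}"]) auto
    next
      case (Suc n)
      then obtain h Z where hZ: "\<forall>s<n. h s \<in> \<H>" "\<forall>t<n. \<forall>s<t. \<eta> * T \<le> card (R (h s) - R (h t))"
        "Z \<subseteq> {..<T}" "card Z \<le> n * D"
        "\<forall>H\<in>\<H>. (\<exists>t\<in>Z. \<phi> t \<in> H) \<or> (\<forall>s<n. \<eta> * T \<le> card (R (h s) - R H))" by auto
      have "card Z \<le> M * D" using hZ(4) Suc.prems by (meson Suc_leD le_trans mult_le_mono1)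
      then obtain H where H: "H \<in> \<H>" "\<And>t. t \<in> Z \<Longrightarrow> \<phi> t \<notin> H" using none hZ(3) by blast
      have "0 < \<delta> * T" using assms \<open>0 < T\<close> by simp
      then have "0 < card (R H)" using \<H>[OF H(1)] unfolding R_def by linarith
      then have RH: "finite (R H)" "R H \<noteq> {}" by (auto simp: card_gt_0_iff)
      obtain Y where Y: "Y \<subseteq> R H" "card Y \<le> D" "\<And>H'. convex H' \<Longrightarrow> convex (- H') \<Longrightarrow>
          D * card {t\<in>R H. \<phi> t \<notin> H'} < card (R H) \<Longrightarrow> \<exists>t\<in>Y. \<phi> t \<in> H'"
        using ex_center_net[OF RH, of \<phi>] unfolding D_def by metis
      have YT: "Y \<subseteq> {..<T}" using Y(1) by (auto simp: R_def)
      have new: "(\<exists>t\<in>Y. \<phi> t \<in> H') \<or> \<eta> * T \<le> card (R H - R H')" if "H' \<in> \<H>" for H'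
      proof (rule disjCI)
        assume "\<not> \<eta> * T \<le> card (R H - R H')"
        then have "card (R H - R H') * real D < \<delta> * T" using D by (simp add: \<eta>_def field_simps)
        also have "\<dots> \<le> card (R H)" using \<H>[OF H(1)] by (simp add: R_def)
        finally have "D * card (R H - R H') < card (R H)" by (metis mult.commute of_nat_less_iff of_nat_mult)
        moreover have "R H - R H' = {t\<in>R H. \<phi> t \<notin> H'}" by (auto simp: R_def)
        ultimately show "\<exists>t\<in>Y. \<phi> t \<in> H'" using Y(3) \<H>[OF that] by simp
      qed
      have "\<eta> * T \<le> card (R (h s) - R H)" if "s < n" for s using hZ(5) H that by blast
      then have sep: "\<forall>t<Suc n. \<forall>s<t. \<eta> * T \<le> card (R ((h(n := H)) s) - R ((h(n := H)) t))"
        using hZ(2) by (auto simp: less_Suc_eq)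
      have "card (Z \<union> Y) \<le> Suc n * D" using hZ(4) Y(2) card_Un_le[of Z Y] by simp
      moreover have "(\<exists>t\<in>Z \<union> Y. \<phi> t \<in> H') \<or> (\<forall>s<Suc n. \<eta> * T \<le> card (R ((h(n := H)) s) - R H'))"
        if "H' \<in> \<H>" for H'
        using hZ(5) new[OF that] that by (auto simp: less_Suc_eq)
      ultimately show ?case
        using hZ(1,3) YT H(1) sep
        by (intro exI[of _ "h(n := H)"] exI[of _ "Z \<union> Y"]) (auto simp: less_Suc_eq)
    qed
    obtain h where h: "\<forall>s<M. h s \<in> \<H>" "\<forall>t<M. \<forall>s<t. \<eta> * T \<le> card (R (h s) - R (h t))"
      using step[of M] by blast
    have "M \<le> (m + 1) ^ D"
    proof (rule separated_sets_bound[of "{..<T}" \<eta> M "\<lambda>s. R (h s)"])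
      show "card S \<le> D" if S: "finite S" "shatters ((\<lambda>s. R (h s)) ` {..<M}) S" for S
      proof -
        have eq: "(\<lambda>H. {t \<in> {..<T}. \<phi> t \<in> H}) ` (h ` {..<M}) = (\<lambda>s. R (h s)) ` {..<M}"
          by (simp add: image_image R_def)
        have "convex H \<and> convex (- H)" if "H \<in> h ` {..<M}" for H using that h(1) \<H> by blast
        then show ?thesis
          unfolding D_def using card_shattered_le_DIM[OF _ S(1) S(2)[folded eq]] by blast
      qed
      show "(real M)\<^sup>2 * (1 - \<eta>) ^ m < 1" using m by (simp add: M_def)
      show "\<eta> * card {..<T} \<le> card (R (h s) - R (h t))" if "s < t" "t < M" for s t
        using h(2) that by simp
      show "R (h s) \<subseteq> {..<T}" for s by (auto simp: R_def)
    qed (use \<eta> \<open>0 < T\<close> in auto)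
    then show False by (simp add: M_def)
  qed
  show ?thesis
  proof (intro exI[of _ "M * D"] allI impI)
    fix \<phi> :: "nat \<Rightarrow> 'e" and T :: nat and \<H> :: "'e set set"
    assume "0 < T"
      "\<forall>H\<in>\<H>. convex H \<and> convex (- H) \<and> \<delta> * real T \<le> card {t. t < T \<and> \<phi> t \<in> H}"
    then show "\<exists>Z\<subseteq>{..<T}. card Z \<le> M * D \<and> (\<forall>H\<in>\<H>. \<exists>t\<in>Z. \<phi> t \<in> H)"
      by (intro main) blast+
  qed
qed

section \<open>Nets for balls and transversals\<close>

text \<open>Move from a common point \<open>x\<close> towards the centre \<open>z\<close> by the
  fraction \<open>1 / \<rho>\<close>. The point \<open>z'\<close> reached has norm at most 2, and
  the unit ball around it lies inside \<open>cball z \<rho>\<close>. So a 1-net of the ball of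
  radius 2 suffices.\<close>

lemma unit_ball_net:
  "\<exists>N::'a::euclidean_space set. finite N \<and>
    (\<forall>z \<rho>. 1 \<le> \<rho> \<longrightarrow> cball z \<rho> \<inter> cball 0 1 \<noteq> {} \<longrightarrow> (\<exists>q\<in>N. q \<in> cball z \<rho>))"
proof -
  have "compact (cball (0::'a) 2)" by simp
  then obtain N where N: "finite N" "cball (0::'a) 2 \<subseteq> (\<Union>x\<in>N. ball x 1)"
    using compact_eq_totally_bounded by (metis zero_less_one)
  have "\<exists>q\<in>N. q \<in> cball z \<rho>" if \<rho>: "1 \<le> \<rho>" and ne: "cball z \<rho> \<inter> cball 0 1 \<noteq> {}" for z \<rho>
  proof -
    obtain x where x: "dist z x \<le> \<rho>" "norm x \<le> 1" using ne by auto
    define z' where "z' = x + (1 / \<rho>) *\<^sub>R (z - x)"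
    have "norm (z' - x) \<le> 1" using x(1) \<rho> by (simp add: z'_def dist_norm divide_simps)
    then have "norm z' \<le> 2" using x(2) norm_triangle_ineq[of "z' - x" x] by simp
    then obtain q where q: "q \<in> N" "dist q z' < 1" using N(2) by (force simp: subset_iff)
    have "z - z' = (1 - 1 / \<rho>) *\<^sub>R (z - x)" by (simp add: z'_def algebra_simps)
    then have "dist z z' = (1 - 1 / \<rho>) * dist z x" using \<rho> by (simp add: dist_norm)
    also have "\<dots> \<le> (1 - 1 / \<rho>) * \<rho>" using x(1) \<rho> by (intro mult_left_mono) auto
    also have "\<dots> = \<rho> - 1" using \<rho> by (simp add: field_simps)
    finally have "dist z q \<le> \<rho>" using q(2) dist_triangle[of z q z'] by (simp add: dist_commute)
    then show ?thesis using q(1) by auto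
  qed
  then show ?thesis using N(1) by blast
qed

text \<open>Only balls at least as large as \<open>B\<close> must be met; this restriction is what
  allows finitely many points. Centre and radius are quantified because \<open>B\<close> is a bare
  set; a set that is no ball imposes finiteness only.\<close>

definition net_of_ball :: "'a::euclidean_space set \<Rightarrow> 'a set \<Rightarrow> bool" where
  "net_of_ball B Q \<longleftrightarrow> finite Q \<and> (\<forall>c r z \<rho>. 0 \<le> r \<longrightarrow> B = cball c r \<longrightarrow> r \<le> \<rho> \<longrightarrow>
     cball z \<rho> \<inter> B \<noteq> {} \<longrightarrow> (\<exists>q\<in>Q. q \<in> cball z \<rho>))"

text \<open>Translated and scaled copies of one net for the unit ball, whence a size bound
  \<open>n\<close> common to all balls.\<close>

lemma ex_ball_nets:
  "\<exists>n. \<exists>Q :: 'a::euclidean_space set \<Rightarrow> 'a set. \<forall>B. net_of_ball B (Q B) \<and> card (Q B) \<le> n"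
proof -
  obtain N :: "'a set" where N: "finite N"
    "\<And>z \<rho>. 1 \<le> \<rho> \<Longrightarrow> cball z \<rho> \<inter> cball 0 1 \<noteq> {} \<Longrightarrow> \<exists>q\<in>N. q \<in> cball z \<rho>"
    using unit_ball_net by blast
  have "\<exists>Q. net_of_ball B Q \<and> card Q \<le> Suc (card N)" for B :: "'a set"
  proof (cases "\<exists>c r. 0 \<le> r \<and> B = cball c r")
    case False
    then have "net_of_ball B {}" by (auto simp: net_of_ball_def)
    then show ?thesis by (intro exI[of _ "{}"]) auto
  next
    case True
    then obtain c r where B: "0 \<le> r" "B = cball c r" by blast
    \<comment> \<open>The centre serves balls of radius 0, which cannot be rescaled to the unit
      ball.\<close>
    define Q where "Q = insert c ((\<lambda>q. c + r *\<^sub>R q) ` N)"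
    have "\<exists>q\<in>Q. q \<in> cball z \<rho>" if r\<rho>: "r \<le> \<rho>" "cball z \<rho> \<inter> B \<noteq> {}" for z \<rho>
    proof (cases "r = 0")
      case True
      then have "c \<in> cball z \<rho>" using r\<rho> B by auto
      then show ?thesis by (auto simp: Q_def)
    next
      case False
      then have r: "0 < r" using B by simp
      obtain y where y: "dist z y \<le> \<rho>" "dist c y \<le> r" using r\<rho>(2) B by auto
      define z' where "z' = (1 / r) *\<^sub>R (z - c)"
      have eq: "dist z (c + r *\<^sub>R q) = r * dist z' q" for q
      proof -
        have "z - (c + r *\<^sub>R q) = r *\<^sub>R (z' - q)" using r by (simp add: z'_def algebra_simps)
        then show ?thesis using r by (simp add: dist_norm)
      qed
      define y' where "y' = (1 / r) *\<^sub>R (y - c)"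
      have yy': "y = c + r *\<^sub>R y'" using r by (simp add: y'_def)
      have "norm y' \<le> 1" using y(2) r by (simp add: y'_def dist_norm norm_minus_commute)
      moreover have "dist z' y' \<le> \<rho> / r" using y(1) eq[of y'] r by (simp add: yy' field_simps)
      ultimately obtain q where "q \<in> N" "dist z' q \<le> \<rho> / r"
        using N(2)[of "\<rho> / r" z'] r \<open>r \<le> \<rho>\<close> by (force simp: divide_simps)
      then have "c + r *\<^sub>R q \<in> cball z \<rho>" using eq[of q] r by (simp add: field_simps)
      then show ?thesis using \<open>q \<in> N\<close> by (auto simp: Q_def)
    qed
    then have "net_of_ball B Q" using N(1) B by (auto simp: net_of_ball_def Q_def cball_eq_cball_iff)
    moreover have "card Q \<le> Suc (card N)"
      using N(1) card_image_le[OF N(1), of "\<lambda>q. c + r *\<^sub>R q"] by (simp add: Q_def card_insert_if)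
    ultimately show ?thesis by blast
  qed
  then show ?thesis by metis
qed

text \<open>If \<open>\<beta> b\<close> minimises \<open>\<bar>\<beta> j\<bar> * r j\<close>, then with the dependency coefficients kept fixed, moving
  the other points within their balls sweeps the \<open>b\<close>-th point over a ball of radius at least \<open>r b\<close>,
  and this ball contains a point of the net of the \<open>b\<close>-th ball.\<close>

lemma dependency_elimination:
  fixes c x :: "'i \<Rightarrow> 'a::euclidean_space" and U :: "('a \<times> real) set"
  assumes "finite J" "b \<in> J" "J \<noteq> {b}"
    and r: "\<And>j. j \<in> J \<Longrightarrow> 0 \<le> r j"
    and net: "net_of_ball (cball (c b) (r b)) Q"
    and U: "subspace U"
    and x: "\<And>j. j \<in> J \<Longrightarrow> x j \<in> cball (c j) (r j)"
    and \<beta>: "\<And>j. j \<in> J \<Longrightarrow> \<beta> j \<noteq> (0::real)"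
    and dep: "(\<Sum>j\<in>J. \<beta> j *\<^sub>R (x j, 1)) \<in> U"
    and min: "\<And>j. j \<in> J \<Longrightarrow> \<bar>\<beta> b\<bar> * r b \<le> \<bar>\<beta> j\<bar> * r j"
  shows "\<exists>q\<in>Q. \<exists>x'. (\<forall>j\<in>J - {b}. x' j \<in> cball (c j) (r j)) \<and>
    (\<Sum>j\<in>J - {b}. \<beta> j *\<^sub>R (x' j, 1)) \<in> span (insert (q, 1) U)"
proof -
  define K where "K = J - {b}"
  have K: "finite K" "K \<noteq> {}" "K \<subseteq> J" using assms(1-3) by (auto simp: K_def)
  define S where "S = (\<Sum>j\<in>K. \<beta> j *\<^sub>R c j)"
  define \<sigma> where "\<sigma> = (\<Sum>j\<in>K. \<bar>\<beta> j\<bar> * r j)"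
  define u where "u = (\<Sum>j\<in>J. \<beta> j *\<^sub>R (x j, 1::real))"
  have u: "u = \<beta> b *\<^sub>R (x b, 1) + (\<Sum>j\<in>K. \<beta> j *\<^sub>R (x j, 1))"
    unfolding u_def K_def using assms(1,2) by (rule sum.remove)
  then have fst_u: "fst u = \<beta> b *\<^sub>R x b + (\<Sum>j\<in>K. \<beta> j *\<^sub>R x j)" by (simp add: fst_sum)
  have snd_u: "snd u = \<beta> b + sum \<beta> K" using u by (simp add: snd_sum)
  have nn: "0 \<le> \<bar>\<beta> j\<bar> * r j" if "j \<in> K" for j using r K that by auto
  obtain j0 where "j0 \<in> K" using K by blast
  then have "\<bar>\<beta> b\<bar> * r b \<le> \<bar>\<beta> j0\<bar> * r j0" using min K by blast
  also have "\<dots> \<le> \<sigma>" unfolding \<sigma>_def using \<open>j0 \<in> K\<close> nn K by (intro member_le_sum) auto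
  finally have \<sigma>: "\<bar>\<beta> b\<bar> * r b \<le> \<sigma>" .
  have \<sigma>0: "0 \<le> \<sigma>" unfolding \<sigma>_def using nn by (rule sum_nonneg)
  have \<beta>b: "\<beta> b \<noteq> 0" using \<beta> assms(2) by blast
  \<comment> \<open>With \<open>y j\<close> ranging over the other balls, the sums of the
    \<open>\<beta> j *\<^sub>R y j\<close> fill the ball with centre \<open>S\<close> and radius
    \<open>\<sigma>\<close>. So \<open>q\<close> can replace \<open>x b\<close> with
    \<open>fst u\<close> unchanged exactly when \<open>\<beta> b *\<^sub>R q\<close> is within
    \<open>\<sigma>\<close> of \<open>fst u - S\<close>, that is, when \<open>q\<close> lies in
    \<open>cball z \<rho>\<close>.\<close>
  define z where "z = (1 / \<beta> b) *\<^sub>R (fst u - S)"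
  define \<rho> where "\<rho> = \<sigma> / \<bar>\<beta> b\<bar>"
  have scale: "norm (fst u - S - \<beta> b *\<^sub>R q) = \<bar>\<beta> b\<bar> * dist z q" for q
  proof -
    have "fst u - S - \<beta> b *\<^sub>R q = \<beta> b *\<^sub>R (z - q)" using \<beta>b by (simp add: z_def algebra_simps)
    then show ?thesis by (simp add: dist_norm)
  qed
  have "fst u - S - \<beta> b *\<^sub>R x b = (\<Sum>j\<in>K. \<beta> j *\<^sub>R (x j - c j))"
    by (simp add: fst_u S_def sum_subtractf algebra_simps)
  also have "norm \<dots> \<le> \<sigma>" unfolding \<sigma>_def
  proof (rule sum_norm_le)
    fix j assume "j \<in> K"
    then have "dist (c j) (x j) \<le> r j" using x K by auto
    then show "norm (\<beta> j *\<^sub>R (x j - c j)) \<le> \<bar>\<beta> j\<bar> * r j"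
      by (simp add: dist_norm norm_minus_commute mult_left_mono)
  qed
  finally have "x b \<in> cball z \<rho>" using scale[of "x b"] \<beta>b by (simp add: \<rho>_def field_simps)
  moreover have "r b \<le> \<rho>" using \<sigma> \<beta>b by (simp add: \<rho>_def field_simps)
  ultimately obtain q where q: "q \<in> Q" "q \<in> cball z \<rho>"
    using net x[OF assms(2)] r[OF assms(2)] unfolding net_of_ball_def by blast
  define v where "v = fst u - S - \<beta> b *\<^sub>R q"
  have v: "norm v \<le> \<sigma>" using q(2) \<beta>b scale[of q] by (simp add: v_def \<rho>_def field_simps)
  \<comment> \<open>The discrepancy \<open>v\<close> is shared among the balls in proportion to
    \<open>\<bar>\<beta> j\<bar> * r j\<close>; the sign makes the contributions add up.\<close>
  define x' where "x' j = c j + (sgn (\<beta> j) * r j / \<sigma>) *\<^sub>R v" for j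
  have "x' j \<in> cball (c j) (r j)" if "j \<in> K" for j
  proof -
    have "j \<in> J" using that K by blast
    then have "norm (x' j - c j) = r j * (norm v / \<sigma>)"
      using r[of j] \<beta>[of j] \<sigma>0 by (simp add: x'_def abs_mult abs_sgn_eq)
    also have "\<dots> \<le> r j * 1"
      using v \<sigma>0 r[OF \<open>j \<in> J\<close>] by (intro mult_left_mono) (auto simp: divide_le_eq_1)
    finally show ?thesis by (simp add: dist_norm norm_minus_commute)
  qed
  moreover have "(\<Sum>j\<in>K. \<beta> j *\<^sub>R (x' j, 1)) = u - \<beta> b *\<^sub>R (q, 1)"
  proof -
    have "(\<Sum>j\<in>K. \<beta> j *\<^sub>R x' j) = S + (\<Sum>j\<in>K. (\<bar>\<beta> j\<bar> * r j / \<sigma>) *\<^sub>R v)"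
      by (simp add: x'_def S_def scaleR_right_distrib sum.distrib abs_sgn mult.assoc)
    also have "(\<Sum>j\<in>K. (\<bar>\<beta> j\<bar> * r j / \<sigma>) *\<^sub>R v) = (\<sigma> / \<sigma>) *\<^sub>R v"
      by (simp only: \<sigma>_def flip: sum_divide_distrib scaleR_sum_left)
    \<comment> \<open>If \<open>\<sigma> = 0\<close>, then \<open>v = 0\<close>, in agreement with
      division by zero giving 0.\<close>
    also have "\<dots> = v" using v by (cases "\<sigma> = 0") auto
    finally show ?thesis by (simp add: prod_eq_iff fst_sum snd_sum snd_u v_def)
  qed
  moreover have "u - \<beta> b *\<^sub>R (q, 1) \<in> span (insert (q, 1) U)"
    using dep unfolding u_def[symmetric]
    by (intro span_diff span_scale) (auto intro: span_base)
  ultimately show ?thesis using q(1) unfolding K_def by (intro bexI[of _ q] exI[of _ x']) auto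
qed

text \<open>Balls are eliminated one by one while \<open>U\<close> absorbs the lifts of the net
  points chosen. The coefficients never change and a nonzero one always survives; when only the ball
  \<open>a\<close> is left, dividing by \<open>\<beta> a\<close> puts its lifted point into
  \<open>U\<close>. Which ball is left depends on the coefficients, hence the existential
  \<open>a\<close>.\<close>

lemma dependent_balls_span:
  fixes c x :: "'i \<Rightarrow> 'a::euclidean_space" and U :: "('a \<times> real) set"
  assumes "finite J"
    and "\<And>j. j \<in> J \<Longrightarrow> 0 \<le> r j"
    and "\<And>j. j \<in> J \<Longrightarrow> net_of_ball (cball (c j) (r j)) (Q j)"
    and "subspace U"
    and "\<And>j. j \<in> J \<Longrightarrow> x j \<in> cball (c j) (r j)"
    and "\<exists>j\<in>J. \<beta> j \<noteq> (0::real)"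
    and "(\<Sum>j\<in>J. \<beta> j *\<^sub>R (x j, 1)) \<in> U"
  shows "\<exists>a\<in>J. \<exists>q\<in>Pi\<^sub>E (J - {a}) Q. \<exists>y\<in>cball (c a) (r a).
    (y, 1) \<in> span (U \<union> (\<lambda>j. (q j, 1)) ` (J - {a}))"
  using assms
proof (induction J arbitrary: U x rule: finite_psubset_induct)
  case (psubset J)
  show ?case
  proof (cases "\<exists>a. J = {a}")
    case True
    then obtain a where a: "J = {a}" by blast
    then have "\<beta> a \<noteq> 0" "\<beta> a *\<^sub>R (x a, 1) \<in> U" using psubset.prems by auto
    then have "(1 / \<beta> a) *\<^sub>R (\<beta> a *\<^sub>R (x a, 1)) \<in> U" using psubset.prems(3) subspace_scale by blast
    then have "(x a, 1) \<in> U" using \<open>\<beta> a \<noteq> 0\<close> by simp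
    \<comment> \<open>Here \<open>J - {a}\<close> is empty, so the image is empty, and the only
      member of the product is the function with constant value \<open>undefined\<close>.\<close>
    then have "(x a, 1) \<in> span (U \<union> (\<lambda>j. (undefined, 1)) ` (J - {a}))" by (auto intro: span_base)
    then show ?thesis using psubset.prems(4)[of a] a by (auto simp: span_base)
  next
    case False
    have ne: "J \<noteq> {}" using psubset.prems by auto
    have "\<exists>b\<in>J. \<exists>q\<in>Q b. \<exists>x'. (\<forall>j\<in>J - {b}. x' j \<in> cball (c j) (r j)) \<and> (\<exists>j\<in>J - {b}. \<beta> j \<noteq> 0) \<and>
      (\<Sum>j\<in>J - {b}. \<beta> j *\<^sub>R (x' j, 1)) \<in> span (insert (q, 1) U)"
    \<comment> \<open>Balls with coefficient 0 go first: dropping one leaves the sum unchanged, and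
      any point of its net may serve as the value of \<open>q\<close> there. The minimality argument
      then has nonzero coefficients only.\<close>
    proof (cases "\<exists>b\<in>J. \<beta> b = 0")
      case True
      then obtain b where b: "b \<in> J" "\<beta> b = 0" by blast
      have "cball (c b) (r b) \<inter> cball (c b) (r b) \<noteq> {}" using psubset.prems(1)[of b] b by simp
      then obtain q where "q \<in> Q b"
        using psubset.prems(1,2) b unfolding net_of_ball_def by blast
      moreover have "(\<Sum>j\<in>J - {b}. \<beta> j *\<^sub>R (x j, 1::real)) = (\<Sum>j\<in>J. \<beta> j *\<^sub>R (x j, 1))"
        using b psubset.hyps by (simp add: sum.remove zero_prod_def)
      then have "(\<Sum>j\<in>J - {b}. \<beta> j *\<^sub>R (x j, 1)) \<in> insert (q, 1) U"
        using psubset.prems(6) by (simp only: insert_iff simp_thms)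
      then have "(\<Sum>j\<in>J - {b}. \<beta> j *\<^sub>R (x j, 1)) \<in> span (insert (q, 1) U)"
        by (rule span_base)
      ultimately show ?thesis using b psubset.prems(4,5)
        by (intro bexI[of _ b] bexI[of _ q] exI[of _ x]) auto
    next
      case False
      define b where "b = arg_min_on (\<lambda>j. \<bar>\<beta> j\<bar> * r j) J"
      have b: "b \<in> J" unfolding b_def using psubset.hyps ne by (intro arg_min_if_finite)
      have "\<bar>\<beta> b\<bar> * r b \<le> \<bar>\<beta> j\<bar> * r j" if "j \<in> J" for j
        unfolding b_def using psubset.hyps ne that by (intro arg_min_least)
      moreover have "J \<noteq> {b}" using \<open>\<not> (\<exists>a. J = {a})\<close> by blast
      ultimately obtain q x' where "q \<in> Q b" "\<forall>j\<in>J - {b}. x' j \<in> cball (c j) (r j)"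
        "(\<Sum>j\<in>J - {b}. \<beta> j *\<^sub>R (x' j, 1)) \<in> span (insert (q, 1) U)"
        using dependency_elimination[OF psubset.hyps b _ psubset.prems(1) psubset.prems(2)[OF b]
            psubset.prems(3,4) _ psubset.prems(6)] False by blast
      moreover have "\<exists>j\<in>J - {b}. \<beta> j \<noteq> 0" using False \<open>J \<noteq> {b}\<close> b by blast
      ultimately show ?thesis using b by blast
    qed
    then obtain b q x' where b: "b \<in> J" "q \<in> Q b" "\<forall>j\<in>J - {b}. x' j \<in> cball (c j) (r j)"
      "\<exists>j\<in>J - {b}. \<beta> j \<noteq> 0" "(\<Sum>j\<in>J - {b}. \<beta> j *\<^sub>R (x' j, 1)) \<in> span (insert (q, 1) U)" by blast
    have "\<exists>a\<in>J - {b}. \<exists>q'\<in>Pi\<^sub>E (J - {b} - {a}) Q. \<exists>y\<in>cball (c a) (r a).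
      (y, 1) \<in> span (span (insert (q, 1) U) \<union> (\<lambda>j. (q' j, 1)) ` (J - {b} - {a}))"
      by (rule psubset.IH[of "J - {b}" "span (insert (q, 1) U)" x']) (use b psubset.prems in auto)
    then obtain a q' y where a: "a \<in> J - {b}" "q' \<in> Pi\<^sub>E (J - {b} - {a}) Q" "y \<in> cball (c a) (r a)"
      "(y, 1) \<in> span (span (insert (q, 1) U) \<union> (\<lambda>j. (q' j, 1)) ` (J - {b} - {a}))" by blast
    define p where "p = q'(b := q)"
    have J: "J - {a} = insert b (J - {b} - {a})" using a b by auto
    have p: "p \<in> Pi\<^sub>E (J - {a}) Q" unfolding J p_def using a(2) b(2) by (intro PiE_fun_upd)
    let ?V = "U \<union> (\<lambda>j. (p j, 1)) ` (J - {a})"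
    have "insert (q, 1) U \<subseteq> ?V" using J by (auto simp: p_def)
    then have "span (insert (q, 1) U) \<subseteq> span ?V" by (rule span_mono)
    moreover have "(\<lambda>j. (q' j, 1)) ` (J - {b} - {a}) \<subseteq> span ?V"
      by (auto simp: p_def intro!: span_base)
    ultimately have "span (span (insert (q, 1) U) \<union> (\<lambda>j. (q' j, 1)) ` (J - {b} - {a})) \<subseteq> span ?V"
      by (simp add: span_minimal)
    then show ?thesis using a p by blast
  qed
qed

text \<open>The last coordinate of the lift forces the coefficients of the linear combination to
  have sum 1.\<close>

lemma mem_affine_hull_if_lift_in_span:
  assumes "finite P" "(y, 1::real) \<in> span ((\<lambda>q. (q, 1)) ` P)"
  shows "y \<in> affine hull P"
proof -
  have inj: "inj_on (\<lambda>q. (q, 1::real)) P" by (auto simp: inj_on_def)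
  obtain u where "(y, 1) = (\<Sum>v\<in>(\<lambda>q. (q, 1::real)) ` P. u v *\<^sub>R v)"
    using assms by (auto simp: span_finite)
  also have "\<dots> = (\<Sum>q\<in>P. u (q, 1) *\<^sub>R (q, 1))" by (simp add: sum.reindex[OF inj])
  finally have "y = (\<Sum>q\<in>P. u (q, 1) *\<^sub>R q)" "(\<Sum>q\<in>P. u (q, 1)) = 1"
    by (simp_all add: prod_eq_iff fst_sum snd_sum)
  then show ?thesis using assms(1) by (auto simp: affine_hull_finite)
qed

text \<open>The \<open>k + 2\<close> points chosen on the flat are affinely dependent, so their
  lifts are linearly dependent and the elimination can start with \<open>U = {0}\<close>. Coinciding
  points are treated separately, because affine dependence is a property of the set of
  points.\<close>

lemma transversal_through_nets:
  fixes B :: "'i \<Rightarrow> 'a::euclidean_space set"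
  assumes "flat k L" "finite J" "card J = k + 2"
    and ball: "\<And>j. j \<in> J \<Longrightarrow> closed_ball (B j)"
    and hit: "\<And>j. j \<in> J \<Longrightarrow> hits L (B j)"
    and net: "\<And>j. j \<in> J \<Longrightarrow> net_of_ball (B j) (Q j)"
  shows "\<exists>a\<in>J. \<exists>q\<in>Pi\<^sub>E (J - {a}) Q. hits (affine hull (q ` (J - {a}))) (B a)"
proof -
  have "\<forall>j\<in>J. \<exists>c r. 0 \<le> r \<and> B j = cball c r" using ball by (auto simp: closed_ball_def)
  then obtain c where "\<forall>j\<in>J. \<exists>r. 0 \<le> r \<and> B j = cball (c j) r" by (rule bchoice[THEN exE])
  then obtain r where "\<forall>j\<in>J. 0 \<le> r j \<and> B j = cball (c j) (r j)" by (rule bchoice[THEN exE])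
  then have cr: "\<And>j. j \<in> J \<Longrightarrow> 0 \<le> r j \<and> B j = cball (c j) (r j)" by blast
  have "\<forall>j\<in>J. \<exists>y. y \<in> L \<and> y \<in> B j" using hit by (auto simp: hits_def)
  then obtain x where x: "\<And>j. j \<in> J \<Longrightarrow> x j \<in> L \<and> x j \<in> B j" by metis
  have "\<exists>\<beta>. (\<exists>j\<in>J. \<beta> j \<noteq> (0::real)) \<and> (\<Sum>j\<in>J. \<beta> j *\<^sub>R (x j, 1::real)) = 0"
  proof (cases "inj_on x J")
    case True
    have "aff_dim (x ` J) \<le> int k" using x aff_dim_subset[of "x ` J" L] \<open>flat k L\<close> by (auto simp: flat_def)
    then have "affine_dependent (x ` J)"
      using assms(3) True affine_independent_iff_card[of "x ` J"] by (auto simp: card_image)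
    then obtain u where u: "sum u (x ` J) = 0" "\<exists>v\<in>x ` J. u v \<noteq> 0" "(\<Sum>v\<in>x ` J. u v *\<^sub>R v) = 0"
      using affine_dependent_explicit_finite[of "x ` J"] \<open>finite J\<close> by auto
    then show ?thesis using True
      by (intro exI[of _ "u \<circ> x"]) (auto simp: sum.reindex prod_eq_iff fst_sum snd_sum)
  next
    case False
    then obtain i j where ij: "i \<in> J" "j \<in> J" "i \<noteq> j" "x i = x j" by (auto simp: inj_on_def)
    let ?\<beta> = "\<lambda>l. if l = i then 1 else if l = j then - 1 else (0::real)"
    have "(\<Sum>l\<in>J. ?\<beta> l *\<^sub>R (x l, 1::real)) = (\<Sum>l\<in>{i, j}. ?\<beta> l *\<^sub>R (x l, 1))"
      using ij \<open>finite J\<close> by (intro sum.mono_neutral_right) (auto simp: zero_prod_def)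
    also have "\<dots> = 0" using ij by (simp add: prod_eq_iff)
    finally show ?thesis using ij by (intro exI[of _ ?\<beta>]) auto
  qed
  then obtain \<beta> where \<beta>: "\<exists>j\<in>J. \<beta> j \<noteq> (0::real)" "(\<Sum>j\<in>J. \<beta> j *\<^sub>R (x j, 1::real)) = 0" by blast
  have "\<exists>a\<in>J. \<exists>q\<in>Pi\<^sub>E (J - {a}) Q. \<exists>y\<in>cball (c a) (r a).
    (y, 1) \<in> span ({0} \<union> (\<lambda>j. (q j, 1::real)) ` (J - {a}))"
    by (rule dependent_balls_span[where x = x and \<beta> = \<beta>])
      (use \<open>finite J\<close> cr x net \<beta> in \<open>auto simp: subspace_0\<close>)
  then obtain a q y where a: "a \<in> J" "q \<in> Pi\<^sub>E (J - {a}) Q" "y \<in> B a"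
    "(y, 1) \<in> span ((\<lambda>j. (q j, 1::real)) ` (J - {a}))" using cr by auto
  then have "(y, 1) \<in> span ((\<lambda>q. (q, 1::real)) ` (q ` (J - {a})))" by (simp add: image_image)
  then have "y \<in> affine hull (q ` (J - {a}))"
    using \<open>finite J\<close> by (intro mem_affine_hull_if_lift_in_span) auto
  then show ?thesis using a unfolding hits_def by blast
qed

text \<open>Net points may coincide or be in special position, while the weight bound concerns flats
  of dimension exactly \<open>k\<close>.\<close>

lemma ex_flat_superset:
  fixes S :: "'a::euclidean_space set"
  assumes "aff_dim S \<le> int k" "k \<le> DIM('a)"
  shows "\<exists>L. flat k L \<and> S \<subseteq> L"
  using assms(1)
proof (induction "nat (int k - aff_dim S)" arbitrary: S)
  case 0
  then have "aff_dim (affine hull S) = int k" by simp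
  then show ?case by (intro exI[of _ "affine hull S"]) (auto simp: flat_def hull_inc)
next
  case (Suc n)
  then have "aff_dim (affine hull S) < int DIM('a)" using assms(2) by simp
  then have "affine hull S \<noteq> UNIV" by (metis aff_dim_UNIV less_irrefl)
  then obtain x where "x \<notin> affine hull S" by blast
  then have "aff_dim (insert x S) = aff_dim S + 1" by (simp add: aff_dim_insert)
  then have "n = nat (int k - aff_dim (insert x S))" "aff_dim (insert x S) \<le> int k"
    using Suc(2) by linarith+
  then obtain L where "flat k L" "insert x S \<subseteq> L" using Suc(1) by blast
  then show ?case by blast
qed

section \<open>Orthonormal frames\<close>

text \<open>Frames are functions on \<open>nat\<close>, free from index \<open>k\<close> on, so that
  they live in a product space where these equations define a closed set.\<close>

definition orthonormal_frame :: "nat \<Rightarrow> (nat \<Rightarrow> 'a::euclidean_space) \<Rightarrow> bool" where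
  "orthonormal_frame k e \<longleftrightarrow> (\<forall>i<k. \<forall>j<k. e i \<bullet> e j = (if i = j then 1 else 0))"

definition frame_flat :: "nat \<Rightarrow> 'a::euclidean_space \<Rightarrow> (nat \<Rightarrow> 'a) \<Rightarrow> 'a set" where
  "frame_flat k a e = (+) a ` span (e ` {..<k})"

lemma mem_frame_flat:
  assumes "orthonormal_frame k e"
  shows "x \<in> frame_flat k a e \<longleftrightarrow> (\<exists>t. x = a + (\<Sum>i<k. t i *\<^sub>R e i))"
proof -
  have inj: "inj_on e {..<k}"
    using assms unfolding orthonormal_frame_def inj_on_def by (metis lessThan_iff zero_neq_one)
  have "span (e ` {..<k}) = range (\<lambda>t. \<Sum>i<k. t i *\<^sub>R e i)"
  proof (intro equalityI subsetI)
    fix y assume "y \<in> span (e ` {..<k})"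
    then obtain u where "y = (\<Sum>v\<in>e ` {..<k}. u v *\<^sub>R v)" by (auto simp: span_finite)
    also have "\<dots> = (\<Sum>i<k. (u \<circ> e) i *\<^sub>R e i)" by (simp add: sum.reindex[OF inj])
    finally show "y \<in> range (\<lambda>t. \<Sum>i<k. t i *\<^sub>R e i)" by blast
  qed (auto intro!: span_sum span_scale intro: span_base)
  then show ?thesis by (auto simp: frame_flat_def)
qed

lemma flat_frame_flat:
  assumes "orthonormal_frame k e"
  shows "flat k (frame_flat k a e)"
proof -
  have inj: "inj_on e {..<k}"
    using assms unfolding orthonormal_frame_def inj_on_def by (metis lessThan_iff zero_neq_one)
  have "pairwise orthogonal (e ` {..<k})"
    using assms unfolding orthonormal_frame_def pairwise_def orthogonal_def by auto
  moreover have "0 \<notin> e ` {..<k}"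
    using assms unfolding orthonormal_frame_def by (metis imageE inner_zero_left lessThan_iff zero_neq_one)
  ultimately have "independent (e ` {..<k})" by (rule pairwise_orthogonal_independent)
  then have "dim (span (e ` {..<k})) = k" using inj by (simp add: dim_eq_card_independent card_image)
  then show ?thesis
    unfolding flat_def frame_flat_def
    by (simp add: subspace_imp_affine aff_dim_translation_eq aff_dim_subspace flip: affine_translation)
qed

text \<open>The base point \<open>b\<close> may be any point of \<open>L\<close>; the compactness
  argument uses this to keep base points bounded.\<close>

lemma ex_frame_flat:
  assumes "flat k L" "b \<in> L"
  shows "\<exists>e. orthonormal_frame k e \<and> L = frame_flat k b e"
proof -
  define S where "S = (+) (- b) ` L"
  have S: "subspace S" unfolding S_def using assms by (intro affine_diffs_subspace) (auto simp: flat_def)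
  have "aff_dim S = int k" using assms by (simp only: S_def aff_dim_translation_eq flat_def)
  then have dim: "dim S = k" using aff_dim_subspace[OF S] by simp
  obtain E where E: "pairwise orthogonal E" "\<And>x. x \<in> E \<Longrightarrow> norm x = 1" "independent E"
      "card E = dim S" "span E = S"
    using orthonormal_basis_subspace[OF S] by metis
  have "finite E" using E(3) by (rule independent_imp_finite)
  then obtain e where e: "bij_betw e {0..<card E} E" using ex_bij_betw_nat_finite by blast
  then have e': "bij_betw e {..<k} E" using E(4) dim by (simp add: atLeast0LessThan)
  have "orthonormal_frame k e"
    unfolding orthonormal_frame_def
  proof (intro allI impI)
    fix i j assume ij: "i < k" "j < k"
    then have "e i \<in> E" "e j \<in> E" using e' by (auto simp: bij_betw_def)
    moreover have "e i = e j \<longleftrightarrow> i = j" using e' ij by (auto simp: bij_betw_def inj_on_def)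
    ultimately show "e i \<bullet> e j = (if i = j then 1 else 0)"
      using E(1,2) by (auto simp: pairwise_def orthogonal_def norm_eq_1)
  qed
  moreover have "L = frame_flat k b e"
    using e' E(5) by (simp add: frame_flat_def bij_betw_def S_def image_image)
  ultimately show ?thesis by blast
qed

text \<open>By Pythagoras the left side of the inequality is the squared distance of
  \<open>c\<close> from the flat, attained at the coefficients \<open>(c - a) \<bullet> e i\<close>
  of the projection. The criterion is closed in \<open>a\<close> and \<open>e\<close> and free of
  quantifiers over points.\<close>

lemma hits_frame_flat_iff:
  assumes e: "orthonormal_frame k e" and "0 \<le> r"
  shows "hits (frame_flat k a e) (cball c r) \<longleftrightarrow>
    (norm (c - a))\<^sup>2 - (\<Sum>i<k. ((c - a) \<bullet> e i)\<^sup>2) \<le> r\<^sup>2"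
proof -
  define v where "v = c - a"
  have norm_t: "(norm (v - (\<Sum>i<k. t i *\<^sub>R e i)))\<^sup>2 =
      (norm v)\<^sup>2 - (\<Sum>i<k. (v \<bullet> e i)\<^sup>2) + (\<Sum>i<k. (t i - v \<bullet> e i)\<^sup>2)" for t
  proof -
    let ?y = "\<Sum>i<k. t i *\<^sub>R e i"
    have "?y \<bullet> ?y = (\<Sum>i<k. \<Sum>j<k. t i * t j * (e i \<bullet> e j))"
      by (simp add: inner_sum_left inner_sum_right sum_distrib_left mult_ac inner_commute)
    also have "\<dots> = (\<Sum>i<k. \<Sum>j<k. if i = j then t i * t j else 0)"
      using e by (intro sum.cong refl) (auto simp: orthonormal_frame_def)
    also have "\<dots> = (\<Sum>i<k. (t i)\<^sup>2)" by (simp add: power2_eq_square)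
    finally have "?y \<bullet> ?y = (\<Sum>i<k. (t i)\<^sup>2)" .
    moreover have "v \<bullet> ?y = (\<Sum>i<k. t i * (v \<bullet> e i))" by (simp add: inner_sum_right)
    ultimately show ?thesis
      by (simp add: power2_norm_eq_inner inner_diff_left inner_diff_right inner_commute[of ?y v]
          power2_diff sum.distrib sum_subtractf sum_distrib_left sum_negf mult.assoc)
  qed
  have hit: "hits (frame_flat k a e) (cball c r) \<longleftrightarrow> (\<exists>t. norm (v - (\<Sum>i<k. t i *\<^sub>R e i)) \<le> r)"
    using mem_frame_flat[OF e]
    by (auto simp: hits_def disjoint_iff dist_norm v_def algebra_simps)
  show ?thesis
  proof
    assume "hits (frame_flat k a e) (cball c r)"
    then obtain t where "norm (v - (\<Sum>i<k. t i *\<^sub>R e i)) \<le> r" using hit by blast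
    then have "(norm (v - (\<Sum>i<k. t i *\<^sub>R e i)))\<^sup>2 \<le> r\<^sup>2" by (intro power_mono) auto
    moreover have "0 \<le> (\<Sum>i<k. (t i - v \<bullet> e i)\<^sup>2)" by (intro sum_nonneg) auto
    ultimately show "(norm (c - a))\<^sup>2 - (\<Sum>i<k. ((c - a) \<bullet> e i)\<^sup>2) \<le> r\<^sup>2"
      using norm_t[of t] unfolding v_def by linarith
  next
    assume "(norm (c - a))\<^sup>2 - (\<Sum>i<k. ((c - a) \<bullet> e i)\<^sup>2) \<le> r\<^sup>2"
    then have "(norm (v - (\<Sum>i<k. (v \<bullet> e i) *\<^sub>R e i)))\<^sup>2 \<le> r\<^sup>2"
      using norm_t[of "\<lambda>i. v \<bullet> e i"] by (simp add: v_def)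
    then have "norm (v - (\<Sum>i<k. (v \<bullet> e i) *\<^sub>R e i)) \<le> r" using \<open>0 \<le> r\<close> by (rule power2_le_imp_le)
    then show "hits (frame_flat k a e) (cball c r)" using hit by (auto intro: exI[of _ "\<lambda>i. v \<bullet> e i"])
  qed
qed

text \<open>The rank-one matrix \<open>x x^T\<close>; it turns the quadratic terms
  \<open>(c \<bullet> e i)\<^sup>2\<close> into inner products of matrices.\<close>

definition outer :: "real ^ 'd \<Rightarrow> real ^ 'd ^ 'd::finite" where
  "outer x = (\<chi> i j. x $ i * x $ j)"

lemma inner_outer: "outer x \<bullet> outer y = (x \<bullet> y)\<^sup>2"
  by (simp add: outer_def inner_vec_def power2_eq_square sum_product mult_ac)

text \<open>The squared distance of \<open>c\<close> from a flat minus \<open>(norm c)\<^sup>2\<close> is affine in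
  \<open>c\<close> and \<open>outer c\<close>, with coefficients depending on the flat only.\<close>

lemma hits_halfspace:
  fixes L :: "(real ^ 'd::finite) set"
  assumes "flat k L"
  shows "\<exists>\<phi>. \<forall>c r. 0 \<le> r \<longrightarrow>
    (hits L (cball c r) \<longleftrightarrow> (1::real, c, outer c) \<bullet> \<phi> \<le> r\<^sup>2 - (norm c)\<^sup>2)"
proof -
  have "L \<noteq> {}" using assms by (auto simp: flat_def)
  then obtain a e where e: "orthonormal_frame k e" "L = frame_flat k a e"
    using ex_frame_flat[OF assms] by blast
  define \<phi> where "\<phi> = ((norm a)\<^sup>2 - (\<Sum>i<k. (a \<bullet> e i)\<^sup>2),
    2 *\<^sub>R (\<Sum>i<k. (a \<bullet> e i) *\<^sub>R e i) - 2 *\<^sub>R a, - (\<Sum>i<k. outer (e i)))"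
  have "(norm (c - a))\<^sup>2 - (\<Sum>i<k. ((c - a) \<bullet> e i)\<^sup>2) = (norm c)\<^sup>2 + (1, c, outer c) \<bullet> \<phi>" for c
  proof -
    have "(\<Sum>i<k. ((c - a) \<bullet> e i)\<^sup>2) = (\<Sum>i<k. (c \<bullet> e i)\<^sup>2) + (\<Sum>i<k. (a \<bullet> e i)\<^sup>2) -
        2 * (\<Sum>i<k. (a \<bullet> e i) * (c \<bullet> e i))"
      by (simp add: inner_diff_left power2_diff sum.distrib sum_subtractf sum_distrib_left mult_ac)
    then show ?thesis
      by (simp add: \<phi>_def inner_prod_def inner_diff_right inner_sum_right inner_outer
          power2_norm_eq_inner inner_diff_left inner_commute[of a c])
  qed
  then have "\<forall>c r. 0 \<le> r \<longrightarrow>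
      (hits L (cball c r) \<longleftrightarrow> (1::real, c, outer c) \<bullet> \<phi> \<le> r\<^sup>2 - (norm c)\<^sup>2)"
    using hits_frame_flat_iff[OF e(1)] unfolding e(2) by (auto simp: algebra_simps)
  then show ?thesis by blast
qed

section \<open>Families hit by few flats\<close>

definition hit_by_flats :: "nat \<Rightarrow> nat \<Rightarrow> 'a::euclidean_space set set \<Rightarrow> bool" where
  "hit_by_flats k n F \<longleftrightarrow> (\<exists>\<L>. finite \<L> \<and> card \<L> \<le> n \<and> (\<forall>L\<in>\<L>. flat k L) \<and>
     (\<forall>B\<in>F. \<exists>L\<in>\<L>. hits L B))"

lemma hit_by_flats_mono: "hit_by_flats k m F \<Longrightarrow> m \<le> n \<Longrightarrow> hit_by_flats k n F"
  unfolding hit_by_flats_def using le_trans by blast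

lemma hit_by_flats_empty [simp]: "hit_by_flats k n {}"
  unfolding hit_by_flats_def by (intro exI[of _ "{}"]) auto

text \<open>Duality: a flat becomes a point \<open>\<phi> t\<close>, and a ball becomes a half-space
  that contains exactly the points of the flats hitting it. The dimension of the new space depends
  on the ambient one only, so the net bound is independent of \<open>T\<close> and
  \<open>F\<close>.\<close>

lemma hit_by_flats_of_fraction:
  fixes \<delta> :: real
  assumes "0 < \<delta>" "\<delta> \<le> 1"
  shows "\<exists>C. \<forall>F T (L :: nat \<Rightarrow> (real ^ 'd::finite) set). (\<forall>B\<in>F. closed_ball B) \<longrightarrow> 0 < T \<longrightarrow>
    (\<forall>t<T. flat k (L t)) \<longrightarrow> (\<forall>B\<in>F. \<delta> * real T \<le> card {t. t < T \<and> hits (L t) B}) \<longrightarrow>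
    hit_by_flats k C F"
proof -
  obtain C where C: "\<forall>(\<phi> :: nat \<Rightarrow> real \<times> (real ^ 'd) \<times> (real ^ 'd ^ 'd)) T \<H>. 0 < T \<longrightarrow>
    (\<forall>H\<in>\<H>. convex H \<and> convex (- H) \<and> \<delta> * real T \<le> card {t. t < T \<and> \<phi> t \<in> H}) \<longrightarrow>
    (\<exists>Z\<subseteq>{..<T}. card Z \<le> C \<and> (\<forall>H\<in>\<H>. \<exists>t\<in>Z. \<phi> t \<in> H))"
    using ex_halfspace_net[OF assms] by (rule exE)
  have "hit_by_flats k C F" if ball: "\<forall>B\<in>F. closed_ball B" and "0 < T" and L: "\<forall>t<T. flat k (L t)"
    and frac: "\<forall>B\<in>F. \<delta> * real T \<le> card {t. t < T \<and> hits (L t) B}"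
    for F T and L :: "nat \<Rightarrow> (real ^ 'd) set"
  proof -
    have "\<forall>t. \<exists>\<phi>. t < T \<longrightarrow> (\<forall>c r. 0 \<le> r \<longrightarrow>
        (hits (L t) (cball c r) \<longleftrightarrow> (1::real, c, outer c) \<bullet> \<phi> \<le> r\<^sup>2 - (norm c)\<^sup>2))"
      using hits_halfspace L by blast
    then obtain \<phi> where \<phi>: "\<forall>t. t < T \<longrightarrow> (\<forall>c r. 0 \<le> r \<longrightarrow>
        (hits (L t) (cball c r) \<longleftrightarrow> (1::real, c, outer c) \<bullet> \<phi> t \<le> r\<^sup>2 - (norm c)\<^sup>2))"
      by (rule choice[THEN exE])
    have ex: "\<exists>H. convex H \<and> convex (- H) \<and> (\<forall>t<T. hits (L t) B \<longleftrightarrow> \<phi> t \<in> H)" if "B \<in> F" for B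
    proof -
      have "closed_ball B" using ball that by blast
      then obtain c r where B: "0 \<le> r" "B = cball c r" unfolding closed_ball_def by blast
      define v where "v = (1::real, c, outer c)"
      define H where "H = {x. v \<bullet> x \<le> r\<^sup>2 - (norm c)\<^sup>2}"
      have "- H = {x. v \<bullet> x > r\<^sup>2 - (norm c)\<^sup>2}" unfolding H_def by auto
      then have "convex H" "convex (- H)"
        unfolding H_def by (simp_all add: convex_halfspace_le convex_halfspace_gt)
      moreover have "hits (L t) B \<longleftrightarrow> \<phi> t \<in> H" if "t < T" for t
        using \<phi> that B by (simp add: H_def v_def)
      ultimately show ?thesis by blast
    qed
    have "\<forall>B\<in>F. \<exists>H. convex H \<and> convex (- H) \<and> (\<forall>t<T. hits (L t) B \<longleftrightarrow> \<phi> t \<in> H)"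
      using ex by (rule ballI)
    then obtain H where "\<forall>B\<in>F. convex (H B) \<and> convex (- H B) \<and> (\<forall>t<T. hits (L t) B \<longleftrightarrow> \<phi> t \<in> H B)"
      by (rule bchoice[THEN exE])
    then have H: "\<And>B. B \<in> F \<Longrightarrow> convex (H B) \<and> convex (- H B) \<and> (\<forall>t<T. hits (L t) B \<longleftrightarrow> \<phi> t \<in> H B)"
      by (rule bspec)
    have "\<delta> * real T \<le> card {t. t < T \<and> \<phi> t \<in> H B}" if "B \<in> F" for B
    proof -
      have "{t. t < T \<and> \<phi> t \<in> H B} = {t. t < T \<and> hits (L t) B}" using H[OF that] by auto
      then show ?thesis using frac that by simp
    qed
    then have "\<forall>H'\<in>H ` F. convex H' \<and> convex (- H') \<and> \<delta> * real T \<le> card {t. t < T \<and> \<phi> t \<in> H'}"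
      using H by blast
    then have "\<exists>Z\<subseteq>{..<T}. card Z \<le> C \<and> (\<forall>H'\<in>H ` F. \<exists>t\<in>Z. \<phi> t \<in> H')"
      by (rule C[THEN spec, THEN spec, THEN spec, THEN mp, OF \<open>0 < T\<close>, THEN mp])
    then obtain Z where Z: "Z \<subseteq> {..<T}" "card Z \<le> C" "\<forall>H'\<in>H ` F. \<exists>t\<in>Z. \<phi> t \<in> H'"
      by (elim exE conjE)
    have fin: "finite Z" using Z(1) finite_subset by blast
    have "card (L ` Z) \<le> C" using card_image_le[OF fin, of L] Z(2) by simp
    moreover have "\<exists>L'\<in>L ` Z. hits L' B" if "B \<in> F" for B
    proof -
      obtain t where t: "t \<in> Z" "\<phi> t \<in> H B" using Z(3) \<open>B \<in> F\<close> by blast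
      then have "t < T" using Z(1) by blast
      then have "hits (L t) B" using t(2) H[OF that] by simp
      then show ?thesis using t(1) by blast
    qed
    ultimately show ?thesis
      unfolding hit_by_flats_def using fin L Z(1) by (intro exI[of _ "L ` Z"]) auto
  qed
  then show ?thesis by (intro exI[of _ C]) simp
qed

text \<open>A substitute for minimax duality: if every weight were heavy on some flat, the weight
  updates would give a list hitting each ball with frequency \<open>\<epsilon> / 4\<close>. The
  length of that list depends on \<open>F\<close>, but \<open>C\<close> is fixed before
  \<open>F\<close>.\<close>

lemma ex_spread_weights:
  fixes \<epsilon> :: real
  assumes "0 < \<epsilon>" "\<epsilon> \<le> 1"
  shows "\<exists>C. \<forall>F :: (real ^ 'd::finite) set set. finite F \<longrightarrow> (\<forall>B\<in>F. closed_ball B) \<longrightarrow>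
    \<not> hit_by_flats k C F \<longrightarrow>
    (\<exists>w. (\<forall>B\<in>F. 0 \<le> w B) \<and> sum w F = 1 \<and> (\<forall>L. flat k L \<longrightarrow> sum w {B\<in>F. hits L B} \<le> \<epsilon>))"
proof -
  have "0 < \<epsilon> / 4" "\<epsilon> / 4 \<le> 1" using assms by auto
  from hit_by_flats_of_fraction[OF this, of k] obtain C where
    C: "\<forall>F T (L :: nat \<Rightarrow> (real ^ 'd) set). (\<forall>B\<in>F. closed_ball B) \<longrightarrow> 0 < T \<longrightarrow>
      (\<forall>t<T. flat k (L t)) \<longrightarrow> (\<forall>B\<in>F. \<epsilon> / 4 * real T \<le> card {t. t < T \<and> hits (L t) B}) \<longrightarrow>
      hit_by_flats k C F" by (rule exE)
  have "\<exists>w. (\<forall>B\<in>F. 0 \<le> w B) \<and> sum w F = 1 \<and> (\<forall>L. flat k L \<longrightarrow> sum w {B\<in>F. hits L B} \<le> \<epsilon>)"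
    if F: "finite F" "\<forall>B\<in>F. closed_ball B" "\<not> hit_by_flats k C F" for F :: "(real ^ 'd) set set"
  proof (rule ccontr)
    assume none: "\<not> ?thesis"
    have ne: "F \<noteq> {}" using F(3) by auto
    have heavy: "\<exists>L\<in>{L. flat k L}. \<epsilon> < sum w {B\<in>F. hits L B}"
      if "\<And>B. B \<in> F \<Longrightarrow> 0 \<le> w B" "sum w F = 1" for w
      using none that by (force simp: not_le)
    have "\<exists>T>0. \<exists>L::nat \<Rightarrow> (real ^ 'd) set. (\<forall>t<T. L t \<in> {L. flat k L}) \<and>
        (\<forall>B\<in>F. \<epsilon> / 4 * real T \<le> card {t. t < T \<and> hits (L t) B})"
      by (rule multiplicative_weights[OF F(1) ne assms heavy])
    then obtain T and L :: "nat \<Rightarrow> (real ^ 'd) set" where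
      "0 < T" "\<forall>t<T. flat k (L t)" "\<forall>B\<in>F. \<epsilon> / 4 * real T \<le> card {t. t < T \<and> hits (L t) B}"
      by blast
    then show False using C F by blast
  qed
  then show ?thesis by (intro exI[of _ C]) simp
qed

text \<open>Flats can escape to infinity, so they are anchored. Take the least \<open>m\<close> that
  works for all finite subfamilies, and a finite \<open>G0\<close> that \<open>m - 1\<close> flats
  cannot hit. Among at most \<open>m\<close> flats hitting \<open>G \<union> G0\<close>, each hits a
  ball of \<open>G0\<close>, as it could be dropped otherwise; so base points can be taken in one
  fixed ball.\<close>

lemma hit_by_flats_compactness:
  fixes F :: "'a::euclidean_space set set"
  assumes ball: "\<And>B. B \<in> F \<Longrightarrow> closed_ball B"
    and fin: "\<And>G. finite G \<Longrightarrow> G \<subseteq> F \<Longrightarrow> hit_by_flats k n G"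
  shows "hit_by_flats k n F"
proof -
  define P where "P m \<longleftrightarrow> (\<forall>G. finite G \<longrightarrow> G \<subseteq> F \<longrightarrow> hit_by_flats k m G)" for m
  define m where "m = (LEAST m. P m)"
  have "P n" using fin by (simp add: P_def)
  then have Pm: "P m" and "m \<le> n" unfolding m_def by (auto intro: LeastI Least_le)
  have "hit_by_flats k m F"
  proof (cases "m = 0")
    case True
    have "F = {}"
    proof (rule ccontr)
      assume "F \<noteq> {}"
      then obtain B where "B \<in> F" by blast
      then have "hit_by_flats k 0 {B}" using Pm True by (simp add: P_def)
      then show False by (auto simp: hit_by_flats_def)
    qed
    then show ?thesis by simp
  next
    case False
    then have "\<not> P (m - 1)" unfolding m_def by (metis diff_less less_one not_less_Least neq0_conv)
    then obtain G0 where G0: "finite G0" "G0 \<subseteq> F" "\<not> hit_by_flats k (m - 1) G0" by (auto simp: P_def)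
    have "bounded B" if "B \<in> G0" for B
      using ball[of B] G0(2) that by (auto simp: closed_ball_def)
    then have "bounded (\<Union>G0)" using G0(1) by (intro bounded_Union) auto
    then obtain \<rho> where "\<forall>x\<in>\<Union>G0. norm x \<le> \<rho>" unfolding bounded_iff by blast
    then have \<rho>: "\<Union>G0 \<subseteq> cball 0 \<rho>" by auto
    have "\<forall>B\<in>F. \<exists>c r. 0 \<le> r \<and> B = cball c r" using ball by (auto simp: closed_ball_def)
    then obtain c where "\<forall>B\<in>F. \<exists>r. 0 \<le> r \<and> B = cball (c B) r" by (rule bchoice[THEN exE])
    then obtain r where "\<forall>B\<in>F. 0 \<le> r B \<and> B = cball (c B) (r B)" by (rule bchoice[THEN exE])
    then have cr: "\<And>B. B \<in> F \<Longrightarrow> 0 \<le> r B" "\<And>B. B \<in> F \<Longrightarrow> B = cball (c B) (r B)" by blast+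
    \<comment> \<open>Coordinate \<open>(s, 0)\<close> holds the base point of the
      \<open>s\<close>-th flat and \<open>(s, Suc i)\<close> its \<open>i\<close>-th direction. Each
      ranges over a compact ball, so Tychonoff applies.\<close>
    define K0 :: "(nat \<times> nat \<Rightarrow> 'a) set" where
      "K0 = (\<Pi>\<^sub>E (s, i)\<in>UNIV. if i = 0 then cball 0 \<rho> else cball 0 1)"
    define O1 :: "(nat \<times> nat \<Rightarrow> 'a) set" where
      "O1 = {f. \<forall>s. orthonormal_frame k (\<lambda>i. f (s, Suc i))}"
    define A where "A B = {f. \<exists>s<m. (norm (c B - f (s, 0)))\<^sup>2 -
      (\<Sum>i<k. ((c B - f (s, 0)) \<bullet> f (s, Suc i))\<^sup>2) \<le> (r B)\<^sup>2}" for B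
    have cont: "continuous_on UNIV (\<lambda>f :: nat \<times> nat \<Rightarrow> 'a. f x)" for x
      by (rule continuous_on_product_coordinates)
    have "compactin (product_topology (\<lambda>i. euclidean) UNIV) K0"
      unfolding K0_def compactin_PiE by auto
    then have "compact K0" by (simp add: euclidean_product_topology)
    moreover have "closed O1"
      unfolding O1_def orthonormal_frame_def
      by (intro closed_Collect_all closed_Collect_imp open_Collect_const closed_Collect_eq
          continuous_on_inner cont continuous_on_const)
    ultimately have "compact (K0 \<inter> O1)" by (rule compact_Int_closed)
    moreover have "closed (A B)" for B
    proof -
      have "A B = (\<Union>s<m. {f. (norm (c B - f (s, 0)))\<^sup>2 -
        (\<Sum>i<k. ((c B - f (s, 0)) \<bullet> f (s, Suc i))\<^sup>2) \<le> (r B)\<^sup>2})" by (auto simp: A_def)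
      moreover have "closed {f. (norm (c B - f (s, 0)))\<^sup>2 -
        (\<Sum>i<k. ((c B - f (s, 0)) \<bullet> f (s, Suc i))\<^sup>2) \<le> (r B)\<^sup>2}" for s :: nat
        by (intro closed_Collect_le continuous_intros cont)
      ultimately show ?thesis by (simp add: closed_UN)
    qed
    moreover have "K0 \<inter> O1 \<inter> \<Inter>(A ` G) \<noteq> {}" if G: "finite G" "G \<subseteq> F" for G
    proof -
      have "hit_by_flats k m (G \<union> G0)" using Pm G G0 by (simp add: P_def)
      then obtain \<L> where \<L>: "finite \<L>" "card \<L> \<le> m" "\<And>L. L \<in> \<L> \<Longrightarrow> flat k L"
        "\<And>B. B \<in> G \<union> G0 \<Longrightarrow> \<exists>L\<in>\<L>. hits L B" unfolding hit_by_flats_def by blast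
      have near: "\<exists>b\<in>L. b \<in> cball 0 \<rho>" if "L \<in> \<L>" for L
      proof -
        have "\<exists>B\<in>G0. hits L B"
        proof (rule ccontr)
          assume "\<not> ?thesis"
          then have "\<forall>B\<in>G0. \<exists>L'\<in>\<L> - {L}. hits L' B" using \<L>(4) by blast
          moreover have "card (\<L> - {L}) \<le> m - 1" using \<L>(1,2) that by simp
          ultimately have "hit_by_flats k (m - 1) G0"
            unfolding hit_by_flats_def using \<L>(1,3) by (intro exI[of _ "\<L> - {L}"]) auto
          then show False using G0 by blast
        qed
        then show ?thesis using \<rho> unfolding hits_def by blast
      qed
      have "G0 \<noteq> {}" using G0(3) by auto
      then have "\<L> \<noteq> {}" using \<L>(4) by blast
      obtain h where h: "bij_betw h {0..<card \<L>} \<L>" using ex_bij_betw_nat_finite[OF \<L>(1)] by blast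
      \<comment> \<open>Fewer than \<open>m\<close> flats may occur, so the enumeration is padded by
        repeating \<open>h 0\<close>.\<close>
      define g where "g s = h (if s < card \<L> then s else 0)" for s
      have "0 < card \<L>" using \<open>\<L> \<noteq> {}\<close> \<L>(1) by (simp add: card_gt_0_iff)
      then have g: "g s \<in> \<L>" for s using h by (auto simp: g_def bij_betw_def)
      have g_surj: "\<exists>s<m. g s = L" if "L \<in> \<L>" for L
      proof -
        have "L \<in> h ` {0..<card \<L>}" using h that by (simp add: bij_betw_def)
        then obtain s where "s < card \<L>" "h s = L" by auto
        then show ?thesis using \<L>(2) by (intro exI[of _ s]) (auto simp: g_def)
      qed
      have "\<forall>s. \<exists>b. b \<in> g s \<and> b \<in> cball 0 \<rho>" using near g by blast
      then obtain b where b: "\<And>s. b s \<in> g s" "\<And>s. b s \<in> cball 0 \<rho>" by metis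
      have "\<forall>s. \<exists>e. orthonormal_frame k e \<and> g s = frame_flat k (b s) e"
        using ex_frame_flat \<L>(3) g b(1) by blast
      then obtain e where e: "\<And>s. orthonormal_frame k (e s)" "\<And>s. g s = frame_flat k (b s) (e s)" by metis
      \<comment> \<open>Directions from index \<open>k\<close> on are set to 0, which lies in the
        unit ball prescribed by \<open>K0\<close>.\<close>
      define f where "f = (\<lambda>(s, i). case i of 0 \<Rightarrow> b s | Suc j \<Rightarrow> if j < k then e s j else 0)"
      have "norm (e s j) = 1" if "j < k" for s j
        using e(1)[of s] that by (simp add: orthonormal_frame_def norm_eq_1)
      then have "f \<in> K0" using b(2) by (auto simp: K0_def f_def split: nat.split)
      moreover have "f \<in> O1" using e(1) by (auto simp: O1_def f_def orthonormal_frame_def)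
      moreover have "f \<in> A B" if "B \<in> G" for B
      proof -
        have BF: "B \<in> F" using that G by blast
        have "\<exists>L\<in>\<L>. hits L B" using \<L>(4) that by blast
        then obtain s where s: "s < m" "hits (g s) B" using g_surj by metis
        then have "hits (frame_flat k (b s) (e s)) (cball (c B) (r B))" using e(2) cr(2)[OF BF] by metis
        then have "(norm (c B - b s))\<^sup>2 - (\<Sum>i<k. ((c B - b s) \<bullet> e s i)\<^sup>2) \<le> (r B)\<^sup>2"
          using hits_frame_flat_iff[OF e(1) cr(1)[OF BF]] by blast
        then show ?thesis using s(1) by (auto simp: A_def f_def)
      qed
      ultimately show ?thesis by blast
    qed
    ultimately have "K0 \<inter> O1 \<inter> \<Inter>(A ` F) \<noteq> {}" by (rule compact_imp_fip_image)
    then obtain f where f: "f \<in> O1" "\<And>B. B \<in> F \<Longrightarrow> f \<in> A B" by blast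
    let ?L = "\<lambda>s. frame_flat k (f (s, 0)) (\<lambda>i. f (s, Suc i))"
    have fr: "orthonormal_frame k (\<lambda>i. f (s, Suc i))" for s using f(1) by (simp add: O1_def)
    have "\<exists>L\<in>?L ` {..<m}. hits L B" if "B \<in> F" for B
    proof -
      obtain s where s: "s < m" "(norm (c B - f (s, 0)))\<^sup>2 -
          (\<Sum>i<k. ((c B - f (s, 0)) \<bullet> f (s, Suc i))\<^sup>2) \<le> (r B)\<^sup>2"
        using f(2)[OF \<open>B \<in> F\<close>] unfolding A_def by blast
      then have "hits (?L s) (cball (c B) (r B))"
        using hits_frame_flat_iff[OF fr cr(1)[OF that]] by blast
      then have "hits (?L s) B" by (subst cr(2)[OF that])
      then show ?thesis using s(1) by blast
    qed
    moreover have "card (?L ` {..<m}) \<le> m" using card_image_le[of "{..<m}" ?L] by simp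
    ultimately show ?thesis
      unfolding hit_by_flats_def using flat_frame_flat[OF fr] by (intro exI[of _ "?L ` {..<m}"]) auto
  qed
  then show ?thesis using \<open>m \<le> n\<close> by (rule hit_by_flats_mono)
qed

theorem theorem4p1:
  fixes k p :: nat
  assumes "0 < k" and "k < CARD('d::finite)" and "k + 2 \<le> p"
  shows "\<exists>C::nat. \<forall>F :: nat \<Rightarrow> (real ^ 'd) set set.
    (\<forall>i\<in>{1..p}. \<forall>B\<in>F i. closed_ball B) \<longrightarrow>
    (\<forall>B :: nat \<Rightarrow> (real ^ 'd) set. (\<forall>i\<in>{1..p}. B i \<in> F i) \<longrightarrow>
       (\<exists>I\<subseteq>{1..p}. card I = k + 2 \<and> (\<exists>L. flat k L \<and> (\<forall>i\<in>I. hits L (B i))))) \<longrightarrow>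
    (\<exists>i\<in>{1..p}. \<exists>\<L>. finite \<L> \<and> card \<L> \<le> C \<and> (\<forall>L\<in>\<L>. flat k L) \<and>
       (\<forall>B\<in>F i. \<exists>L\<in>\<L>. hits L B))"
proof -
  obtain n and Q :: "(real ^ 'd) set \<Rightarrow> (real ^ 'd) set" where
    "\<forall>B. net_of_ball B (Q B) \<and> card (Q B) \<le> n" using ex_ball_nets by (elim exE)
  then have Q: "net_of_ball B (Q B)" "card (Q B) \<le> n" for B by auto
  \<comment> \<open>At most \<open>2 ^ p * p\<close> pairs of an index set and a distinguished
    index, each with at most \<open>n ^ (k + 1)\<close> choices of net points. Weight
    \<open>1 / (N + 1)\<close> per flat keeps the total below 1, also when
    \<open>N = 0\<close>.\<close>
  define N where "N = real (2 ^ p * p * n ^ (k + 1))"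
  define \<epsilon> where "\<epsilon> = 1 / (N + 1)"
  have N: "0 \<le> N" by (simp add: N_def)
  then have \<epsilon>: "0 < \<epsilon>" "\<epsilon> \<le> 1" by (simp_all add: \<epsilon>_def)
  obtain C where C: "\<forall>F :: (real ^ 'd) set set. finite F \<longrightarrow> (\<forall>B\<in>F. closed_ball B) \<longrightarrow>
    \<not> hit_by_flats k C F \<longrightarrow>
    (\<exists>w. (\<forall>B\<in>F. 0 \<le> w B) \<and> sum w F = 1 \<and> (\<forall>L. flat k L \<longrightarrow> sum w {B\<in>F. hits L B} \<le> \<epsilon>))"
    using ex_spread_weights[OF \<epsilon>, of k] by (rule exE)
  have "\<exists>i\<in>{1..p}. hit_by_flats k C (F i)"
    if ball: "\<forall>i\<in>{1..p}. \<forall>B\<in>F i. closed_ball B"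
      and rainbow: "\<forall>B :: nat \<Rightarrow> (real ^ 'd) set. (\<forall>i\<in>{1..p}. B i \<in> F i) \<longrightarrow>
       (\<exists>I\<subseteq>{1..p}. card I = k + 2 \<and> (\<exists>L. flat k L \<and> (\<forall>i\<in>I. hits L (B i))))"
    for F :: "nat \<Rightarrow> (real ^ 'd) set set"
  proof (rule ccontr)
    assume none: "\<not> ?thesis"
    have "\<exists>G. finite G \<and> G \<subseteq> F i \<and> \<not> hit_by_flats k C G" if "i \<in> {1..p}" for i
    proof (rule ccontr)
      assume "\<not> ?thesis"
      then have "hit_by_flats k C (F i)"
        using ball that hit_by_flats_compactness[of "F i" k C] by blast
      then show False using none that by blast
    qed
    then have "\<forall>i\<in>{1..p}. \<exists>G. finite G \<and> G \<subseteq> F i \<and> \<not> hit_by_flats k C G" by blast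
    then obtain G where "\<forall>i\<in>{1..p}. finite (G i) \<and> G i \<subseteq> F i \<and> \<not> hit_by_flats k C (G i)"
      by (rule bchoice[THEN exE])
    then have G: "finite (G i)" "G i \<subseteq> F i" "\<not> hit_by_flats k C (G i)" if "i \<in> {1..p}" for i
      using that by blast+
    have "\<forall>i\<in>{1..p}. \<exists>w. (\<forall>B\<in>G i. 0 \<le> w B) \<and> sum w (G i) = (1::real) \<and>
      (\<forall>L. flat k L \<longrightarrow> sum w {B\<in>G i. hits L B} \<le> \<epsilon>)"
    proof
      fix i assume i: "i \<in> {1..p}"
      then have "\<forall>B\<in>G i. closed_ball B" using G(2) ball by blast
      then show "\<exists>w. (\<forall>B\<in>G i. 0 \<le> w B) \<and> sum w (G i) = (1::real) \<and>
          (\<forall>L. flat k L \<longrightarrow> sum w {B\<in>G i. hits L B} \<le> \<epsilon>)"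
        using C G(1,3)[OF i] by blast
    qed
    then obtain w where "\<forall>i\<in>{1..p}. (\<forall>B\<in>G i. 0 \<le> w i B) \<and> sum (w i) (G i) = (1::real) \<and>
      (\<forall>L. flat k L \<longrightarrow> sum (w i) {B\<in>G i. hits L B} \<le> \<epsilon>)" by (rule bchoice[THEN exE])
    then have w: "\<And>B. B \<in> G i \<Longrightarrow> 0 \<le> w i B" "sum (w i) (G i) = (1::real)"
      "\<And>L. flat k L \<Longrightarrow> sum (w i) {B\<in>G i. hits L B} \<le> \<epsilon>" if "i \<in> {1..p}" for i
      using that by blast+
    define K where "K = {(I, a). I \<subseteq> {1..p} \<and> card I = k + 2 \<and> a \<in> I}"
    \<comment> \<open>The product omits the index \<open>a\<close>, so \<open>bad (I, a) f\<close>
      does not depend on \<open>f a\<close>, as the union bound requires.\<close>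
    define E where "E = (\<lambda>(I :: nat set, a) f. Pi\<^sub>E (I - {a}) (\<lambda>j. Q (f j)))"
    define bad where "bad = (\<lambda>(I, a) f. {B. \<exists>q\<in>E (I, a) f. hits (affine hull (q ` (I - {a :: nat}))) B})"
    have sub: "K \<subseteq> Pow {1..p} \<times> {1..p}" by (auto simp: K_def)
    then have fK: "finite K" by (rule finite_subset) auto
    have "card K \<le> 2 ^ p * p" using card_mono[OF _ sub] by (simp add: card_cartesian_product card_Pow)
    then have "card K * (n ^ (k + 1) * \<epsilon>) \<le> real (2 ^ p * p) * (n ^ (k + 1) * \<epsilon>)"
      using \<epsilon> by (intro mult_right_mono) (simp_all only: of_nat_le_iff, simp)
    also have "\<dots> = N / (N + 1)" by (simp add: N_def \<epsilon>_def)
    also have "\<dots> < 1" using N by simp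
    finally have less1: "card K * (n ^ (k + 1) * \<epsilon>) < 1" .
    have mass: "sum (w a) (G a \<inter> bad (I, a) f) \<le> n ^ (k + 1) * \<epsilon>" if "(I, a) \<in> K" for I a f
    proof -
      have Ia: "I \<subseteq> {1..p}" "card I = k + 2" "a \<in> I" "finite I"
        using that finite_subset by (auto simp: K_def)
      then have a: "a \<in> {1..p}" and cI: "card (I - {a}) = k + 1" by auto
      have fE: "finite (E (I, a) f)"
        using Q(1) Ia(4) by (auto simp: E_def net_of_ball_def intro!: finite_PiE)
      have "card (E (I, a) f) = (\<Prod>j\<in>I - {a}. card (Q (f j)))" using Ia(4) by (simp add: E_def card_PiE)
      also have "\<dots> \<le> (\<Prod>j\<in>I - {a}. n)" using Q(2) by (intro prod_mono) auto
      finally have cE: "card (E (I, a) f) \<le> n ^ (k + 1)" using cI by simp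
      note wnn = w(1)[OF a]
      have one: "sum (w a) {B\<in>G a. hits (affine hull (q ` (I - {a}))) B} \<le> \<epsilon>" for q
      proof -
        have "aff_dim (q ` (I - {a})) \<le> int (card (q ` (I - {a}))) - 1"
          using Ia(4) by (intro aff_dim_le_card) auto
        also have "\<dots> \<le> int k" using card_image_le[of "I - {a}" q] Ia(4) cI by simp
        finally obtain L where L: "flat k L" "q ` (I - {a}) \<subseteq> L"
          using ex_flat_superset[of "q ` (I - {a})" k] assms(2) by auto
        then have "affine hull (q ` (I - {a})) \<subseteq> L" by (intro hull_minimal) (auto simp: flat_def)
        then have "{B\<in>G a. hits (affine hull (q ` (I - {a}))) B} \<subseteq> {B\<in>G a. hits L B}"
          unfolding hits_def by blast
        then have "sum (w a) {B\<in>G a. hits (affine hull (q ` (I - {a}))) B} \<le> sum (w a) {B\<in>G a. hits L B}"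
          using G(1)[OF a] wnn by (intro sum_mono2) auto
        also have "\<dots> \<le> \<epsilon>" using w(3)[OF a L(1)] .
        finally show ?thesis .
      qed
      have "G a \<inter> bad (I, a) f = (\<Union>q\<in>E (I, a) f. {B\<in>G a. hits (affine hull (q ` (I - {a}))) B})"
        by (auto simp: bad_def)
      also have "sum (w a) \<dots> \<le> (\<Sum>q\<in>E (I, a) f. sum (w a) {B\<in>G a. hits (affine hull (q ` (I - {a}))) B})"
        using fE G(1)[OF a] wnn by (intro sum_UNION_le) auto
      also have "\<dots> \<le> (\<Sum>q\<in>E (I, a) f. \<epsilon>)" using one by (intro sum_mono)
      also have "\<dots> = card (E (I, a) f) * \<epsilon>" by simp
      also have "\<dots> \<le> n ^ (k + 1) * \<epsilon>"
        using of_nat_mono[OF cE, where 'a = real] \<epsilon> by (intro mult_right_mono) (assumption, simp)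
      finally show ?thesis .
    qed
    have "\<exists>f\<in>Pi\<^sub>E {1..p} G. \<forall>\<kappa>\<in>K. f (snd \<kappa>) \<notin> bad \<kappa> f"
    proof (rule ex_choice_avoiding[where \<mu> = w and \<delta> = "n ^ (k + 1) * \<epsilon>"])
      show "bad \<kappa> (f(snd \<kappa> := y)) = bad \<kappa> f" if "\<kappa> \<in> K" for \<kappa> f y
      proof -
        obtain I a where \<kappa>: "\<kappa> = (I, a)" by (cases \<kappa>)
        have "E (I, a) (f(a := y)) = E (I, a) f" unfolding E_def by (auto intro!: PiE_cong)
        then show ?thesis by (simp add: bad_def \<kappa>)
      qed
      show "sum (w (snd \<kappa>)) (G (snd \<kappa>) \<inter> bad \<kappa> f) \<le> n ^ (k + 1) * \<epsilon>" if "\<kappa> \<in> K" for \<kappa> f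
        using mass[of "fst \<kappa>" "snd \<kappa>" f] that by simp
      show "snd \<kappa> \<in> {1..p}" if "\<kappa> \<in> K" for \<kappa> using that sub by auto
    qed (fact finite_atLeastAtMost G(1) w(1,2) fK less1)+
    then obtain f where f: "f \<in> Pi\<^sub>E {1..p} G" "\<forall>\<kappa>\<in>K. f (snd \<kappa>) \<notin> bad \<kappa> f" by (elim bexE)
    have fF: "f i \<in> F i" if "i \<in> {1..p}" for i using PiE_mem[OF f(1) that] G(2)[OF that] by blast
    then have "\<forall>i\<in>{1..p}. f i \<in> F i" by blast
    then obtain I L where I: "I \<subseteq> {1..p}" "card I = k + 2" "flat k L" "\<forall>i\<in>I. hits L (f i)"
      using rainbow[THEN spec, of f] by (elim impE exE conjE)
    \<comment> \<open>The rainbow hypothesis puts \<open>k + 2\<close> of the chosen balls on a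
      common flat; the nets then produce exactly a coincidence that \<open>f\<close> was chosen to
      avoid.\<close>
    have "\<exists>a\<in>I. \<exists>q\<in>Pi\<^sub>E (I - {a}) (\<lambda>j. Q (f j)). hits (affine hull (q ` (I - {a}))) (f a)"
    proof (rule transversal_through_nets[OF I(3) _ I(2)])
      show "finite I" using I(1) finite_subset by blast
      show "closed_ball (f j)" if "j \<in> I" for j using ball fF I(1) that by blast
    qed (use I(4) Q(1) in auto)
    then obtain a where "a \<in> I" "f a \<in> bad (I, a) f" by (auto simp: bad_def E_def)
    then show False using bspec[OF f(2), of "(I, a)"] I(1,2) by (simp add: K_def)
  qed
  then show ?thesis unfolding hit_by_flats_def by (intro exI[of _ C] allI impI)
qed

end
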